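(* Suppose A1, A2, A3, A4, A5, A6 and A7 (stated in the context) hold, and let $\{\theta_i^t\}$ be generated by the DSGD algorithm with $\theta_i^0=\theta_j^0$ for all $i,j$. Suppose that there exists $b>0$ such that $$\sup_{t\ge 1}\gamma_t\le \min\left\{\frac{\rho}{9L},\ \sqrt{\frac{\rho/(4b)}{1-\rho/2}},\ \sqrt[4]{\frac{\rho/(4b)}{1-\rho/2}}\right\}\quad\text{and}\quad \frac{\gamma_t^4}{\gamma_{t+1}^4}\le 1+b\gamma_{t+1}^4\ \text{ for all } t\ge 1 .$$ Let $\mathsf D=f(\bar\theta^0)-f^\star$. Then for any $T\ge 1$, $$\mathbb E\left[\sum_{t=0}^{T-1}\gamma_{t+1}\|\nabla f(\bar\theta^t)\|^2\right]\le 4\mathsf D+\frac{2L\sigma^2}{n}\sum_{t=0}^{T-1}\gamma_{t+1}^2+\frac{432\,n\,L_H^2}{\rho^4}(\sigma^4+4\varsigma^4)\sum_{t=0}^{T-1}\gamma_{t+1}^5+\frac{32\varsigma_H^2(\sigma^2+\varsigma^2)}{\rho^2}\sum_{t=0}^{T-1}\gamma_{t+1}^3 .$$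
   Context: Problem. There are $n$ agents; agent $i\in\{1,\dots,n\}$ has a data distribution $\mathsf B_i$ on a space $\mathsf Z$ and local objective $f_i(\theta)=\mathbb E_{z_i\sim\mathsf B_i}[\ell(\theta;z_i)]$, $\theta\in\mathbb R^d$, where $\ell:\mathbb R^d\times\mathsf Z\to\mathbb R$ is a loss function (possibly non-convex) and $\nabla\ell$ is its gradient in $\theta$. Put $f=\frac1n\sum_{i=1}^n f_i$ and $f^\star=\min_{\theta\in\mathbb R^d}f(\theta)>-\infty$. Agents communicate over an undirected graph $\mathcal G=(\{1,\dots,n\},\mathcal E)$ with all self loops $(i,i)\in\mathcal E$, endowed with a symmetric mixing matrix $W\in\mathbb R^{n\times n}$ with $W_{ij}=W_{ji}>0$ if $(i,j)\in\mathcal E$ and $W_{ij}=W_{ji}=0$ otherwise. DSGD. From given initial points $\theta_i^0\in\mathbb R^d$, for $t\ge0$ and $i=1,\dots,n$, $$\theta_i^{t+1}=\sum_{j=1}^nW_{ij}\theta_j^t-\gamma_{t+1}\nabla\ell(\theta_i^t;z_i^{t+1}),$$ where $z_i^{t+1}\sim\mathsf B_i$ are drawn independently (across agents and iterations) and $\gamma_{t+1}>0$ are deterministic step sizes. The averaged iterate is $\bar\theta^t=\frac1n\sum_{i=1}^n\theta_i^t$. $\mathbb E[\cdot]$ is the total expectation. $\|\cdot\|$ is the Euclidean norm of a vector or the spectral norm of a matrix, and $\mathbf 1$ is the all-one vector in $\mathbb R^n$. A1: $W\mathbf 1=W^\top\mathbf 1=\mathbf 1$ (doubly stochastic), and there exist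 $\rho\in(0,1]$ and $U\in\mathbb R^{n\times(n-1)}$ with $I-\frac1n\mathbf 1\mathbf 1^\top=UU^\top$ and $\|U^\top WU\|\le1-\rho$. A2: there is $L\ge0$ with $\|\nabla f_i(\theta')-\nabla f_i(\theta)\|\le L\|\theta'-\theta\|$ for all $i$ and all $\theta,\theta'\in\mathbb R^d$. A3: for every $i$ and fixed $\theta$, $\mathbb E_{z_i\sim\mathsf B_i}[\nabla\ell(\theta;z_i)]=\nabla f_i(\theta)$, and there is $\sigma\ge0$ with $\mathbb E_{z_i\sim\mathsf B_i}[\|\nabla\ell(\theta;z_i)-\nabla f_i(\theta)\|^2]\le\sigma^2$. A4: there is $\varsigma\ge0$ with $\|\nabla f(\theta)-\nabla f_i(\theta)\|\le\varsigma$ for all $i$ and $\theta$. A5: each $f_i$ is twice continuously differentiable and there is $L_H\ge0$ with $\|\nabla^2f_i(\theta')-\nabla^2f_i(\theta)\|\le L_H\|\theta'-\theta\|$ for all $i,\theta,\theta'$. A6: there is $\varsigma_H\ge0$ with $\|\nabla^2f(\theta)-\nabla^2f_i(\theta)\|\le\varsigma_H$ for all $i$ and $\theta$. A7: for every $i$ and fixed $\theta$, $\mathbb E_{z\sim\mathsf B_i}[\nabla\ell(\theta;z)]=\nabla f_i(\theta)$ and $\mathbb E_{z\sim\mathsf B_i}[\|\nabla\ell(\theta;z)-\nabla f_i(\theta)\|^4]\le\sigma^4$ (with the same constant $\sigma$ as in A3). *)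

theory Defs
  imports
    "HOL-Probability.Probability"
    "Jordan_Normal_Form.Matrix"
begin

text \<open>
  Agents are the indices \<open>i < n\<close>.  The mixing matrix and the matrix \<open>U\<close> of size \<open>n \<times> (n - 1)\<close> are
  matrices with explicit carriers (which also covers \<open>n = 1\<close>); parameters \<open>\<theta>\<close> live in \<open>real ^ 'd\<close>.
\<close>

definition grad :: "('a::real_inner \<Rightarrow> real) \<Rightarrow> 'a \<Rightarrow> 'a" where
  "grad f x = (THE g. GDERIV f x :> g)"

text \<open>
  The Hessian is the derivative of the gradient as a bounded linear map; the norm of the type
  \<open>'a \<Rightarrow>\<^sub>L 'a\<close> is the operator norm, that is, the spectral norm of the Hessian matrix.
\<close>

definition hessian :: "('a::euclidean_space \<Rightarrow> real) \<Rightarrow> 'a \<Rightarrow> 'a \<Rightarrow>\<^sub>L 'a" where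
  "hessian f x = Blinfun (frechet_derivative (grad f) (at x))"

definition twice_continuously_differentiable :: "('a::euclidean_space \<Rightarrow> real) \<Rightarrow> bool" where
  "twice_continuously_differentiable f \<longleftrightarrow>
     (\<forall>x. f differentiable at x) \<and> (\<forall>x. grad f differentiable at x) \<and>
     continuous_on UNIV (hessian f)"

definition vec_norm2 :: "real Matrix.vec \<Rightarrow> real" where
  "vec_norm2 v = sqrt (scalar_prod v v)"

definition spectral_norm :: "real Matrix.mat \<Rightarrow> real" where
  "spectral_norm A = Sup {vec_norm2 (A *\<^sub>v v) |v. v \<in> carrier_vec (dim_col A) \<and> vec_norm2 v \<le> 1}"

definition ones_vec :: "nat \<Rightarrow> real Matrix.vec" where
  "ones_vec n = Matrix.vec n (\<lambda>_. 1)"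

definition ones_mat :: "nat \<Rightarrow> real Matrix.mat" where
  "ones_mat n = Matrix.mat n n (\<lambda>_. 1)"

definition comm_graph :: "nat \<Rightarrow> (nat \<times> nat) set \<Rightarrow> bool" where
  "comm_graph n E \<longleftrightarrow> E \<subseteq> {..<n} \<times> {..<n} \<and> sym E \<and> (\<forall>i<n. (i, i) \<in> E)"

definition mixing_matrix :: "nat \<Rightarrow> (nat \<times> nat) set \<Rightarrow> real Matrix.mat \<Rightarrow> bool" where
  "mixing_matrix n E W \<longleftrightarrow> W \<in> carrier_mat n n \<and>
     (\<forall>i<n. \<forall>j<n. W $$ (i, j) = W $$ (j, i) \<and>
        (if (i, j) \<in> E then W $$ (i, j) > 0 else W $$ (i, j) = 0))"

definition local_obj :: "(nat \<Rightarrow> 'z measure) \<Rightarrow> ('a \<Rightarrow> 'z \<Rightarrow> real) \<Rightarrow> nat \<Rightarrow> 'a \<Rightarrow> real" where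
  "local_obj B l i \<theta> = (\<integral>z. l \<theta> z \<partial>B i)"

definition global_obj :: "nat \<Rightarrow> (nat \<Rightarrow> 'z measure) \<Rightarrow> ('a \<Rightarrow> 'z \<Rightarrow> real) \<Rightarrow> 'a \<Rightarrow> real" where
  "global_obj n B l \<theta> = (\<Sum>i<n. local_obj B l i \<theta>) / real n"

definition grad_loss :: "('a::real_inner \<Rightarrow> 'z \<Rightarrow> real) \<Rightarrow> 'a \<Rightarrow> 'z \<Rightarrow> 'a" where
  "grad_loss l \<theta> z = grad (\<lambda>\<theta>'. l \<theta>' z) \<theta>"

text \<open>
  \<open>dsgd n W \<gamma> l \<theta>0 \<zeta> t i\<close> is the iterate of agent \<open>i\<close> at time \<open>t\<close> along one realisation of the data,
  where \<open>\<zeta> i t\<close> is the sample drawn by agent \<open>i\<close> at time \<open>t \<ge> 1\<close>.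
\<close>

primrec dsgd :: "nat \<Rightarrow> real Matrix.mat \<Rightarrow> (nat \<Rightarrow> real) \<Rightarrow> ('a::real_inner \<Rightarrow> 'z \<Rightarrow> real) \<Rightarrow>
    (nat \<Rightarrow> 'a) \<Rightarrow> (nat \<Rightarrow> nat \<Rightarrow> 'z) \<Rightarrow> nat \<Rightarrow> nat \<Rightarrow> 'a" where
  "dsgd n W \<gamma> l \<theta>0 \<zeta> 0 = \<theta>0"
| "dsgd n W \<gamma> l \<theta>0 \<zeta> (Suc t) = (\<lambda>i.
     (\<Sum>j<n. W $$ (i, j) *\<^sub>R dsgd n W \<gamma> l \<theta>0 \<zeta> t j)
       - \<gamma> (Suc t) *\<^sub>R grad_loss l (dsgd n W \<gamma> l \<theta>0 \<zeta> t i) (\<zeta> i (Suc t)))"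

definition avg :: "nat \<Rightarrow> (nat \<Rightarrow> 'a::real_vector) \<Rightarrow> 'a" where
  "avg n x = (1 / real n) *\<^sub>R (\<Sum>i<n. x i)"

end

theory Submission
  imports Defs
begin

text \<open>
  The mean iterate performs stochastic gradient descent on \<open>f\<close> with a biased gradient: it moves along the average of the
  local gradients taken at the agents' own positions instead of the gradient of \<open>f\<close> at the mean. By the descent
  inequality (\<open>objective_Suc_le\<close>, \<open>expected_descent\<close>), the step sizes times the squared gradients sum up to at
  most twice the initial gap, plus the noise term with variance \<open>\<sigma>\<^sup>2 / n\<close>, plus the step sizes times the squared bias.

  The bias is small because its first-order part almost cancels. If all agents had the same Hessian, the linear terms
  of the local gradients at the mean would add up to zero, as the deviations from the mean do. Hence the bias
  is bounded by the Hessian heterogeneity times the consensus error, plus the Lipschitz constant of the Hessian times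
  its square (\<open>gradient_bias_le\<close>). After squaring, second and fourth moments of the consensus error
  are needed, of orders \<open>\<gamma>\<^sup>2\<close> and \<open>\<gamma>\<^sup>4\<close>; together with the weight \<open>\<gamma>\<close> they produce the third and fifth powers in the bound.

  For these moments, gossip with spectral gap \<open>\<rho>\<close> contracts deviations by \<open>1 - \<rho>\<close> (\<open>mixing_contracts\<close>), while gradients
  at most increase the factor to \<open>1 - 8 \<rho> / 9\<close> and add heterogeneity and noise of order \<open>\<gamma>\<close> (\<open>drift_le\<close>).
  In the second and fourth power of the new error the terms linear in the noise have mean zero, so both moments satisfy a
  contractive recursion (\<open>consensus_second_moment_Suc\<close>, \<open>consensus_fourth_moment_Suc\<close>). The step sizes decrease
  so slowly that the contraction compensates the decrease, and the moments stay proportional to the powers of the current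
  step size (\<open>consensus_second_moment_le\<close>, \<open>consensus_fourth_moment_le\<close>).

  Noise moments and orthogonality (\<open>noise_moment\<close>, \<open>noise_orthogonal\<close>) come from Fubini's theorem: an iterate is a
  function of earlier samples, hence independent of the sample it is combined with. This needs the stochastic gradient to be
  jointly measurable in position and sample, which follows from differentiability of the loss (\<open>grad_loss_measurable\<close>).
\<close>

section \<open>Contraction of the mixing matrix on zero-sum vectors\<close>

lemma vec_norm2_power2: "vec_norm2 v ^ 2 = (\<Sum>i<dim_vec v. (vec_index v i)\<^sup>2)"
  unfolding vec_norm2_def scalar_prod_def
  by (subst real_sqrt_pow2) (auto simp: sum_nonneg power2_eq_square lessThan_atLeast0)

lemma vec_norm2_nonneg: "vec_norm2 v \<ge> 0"
  unfolding vec_norm2_def scalar_prod_def by (auto simp: sum_nonneg)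

lemma vec_norm2_smult: "vec_norm2 (c \<cdot>\<^sub>v v) = \<bar>c\<bar> * vec_norm2 v"
proof -
  have "vec_norm2 (c \<cdot>\<^sub>v v) ^ 2 = (\<bar>c\<bar> * vec_norm2 v) ^ 2"
    unfolding vec_norm2_power2 power_mult_distrib
    by (auto simp: power_mult_distrib sum_distrib_left)
  then show ?thesis
    by (simp add: vec_norm2_nonneg power2_eq_iff_nonneg)
qed

lemma vec_norm2_mult_mat_le:
  assumes "v \<in> carrier_vec (dim_col A)"
  shows "vec_norm2 (A *\<^sub>v v) ^ 2
    \<le> (\<Sum>i<dim_row A. \<Sum>j<dim_col A. (A $$ (i, j))\<^sup>2) * vec_norm2 v ^ 2"
proof -
  have "vec_index (A *\<^sub>v v) i = (\<Sum>j<dim_col A. A $$ (i, j) * vec_index v j)" if "i < dim_row A" for i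
    using that assms by (auto simp: scalar_prod_def lessThan_atLeast0)
  then have "vec_norm2 (A *\<^sub>v v) ^ 2 = (\<Sum>i<dim_row A. (\<Sum>j<dim_col A. A $$ (i, j) * vec_index v j)\<^sup>2)"
    unfolding vec_norm2_power2 by simp
  also have "\<dots> \<le> (\<Sum>i<dim_row A. (\<Sum>j<dim_col A. (A $$ (i, j))\<^sup>2) * (\<Sum>j<dim_col A. (vec_index v j)\<^sup>2))"
    by (intro sum_mono Cauchy_Schwarz_ineq_sum)
  also have "\<dots> = (\<Sum>i<dim_row A. \<Sum>j<dim_col A. (A $$ (i, j))\<^sup>2) * vec_norm2 v ^ 2"
    using assms unfolding vec_norm2_power2 by (simp add: sum_distrib_right carrier_vecD)
  finally show ?thesis .
qed

text \<open>
  The set in the definition of the spectral norm is bounded above by the Frobenius norm, so its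
  supremum really is an upper bound on the unit ball; homogeneity extends the bound to all vectors.
\<close>

lemma vec_norm2_mult_mat_spectral:
  assumes v: "v \<in> carrier_vec (dim_col A)"
  shows "vec_norm2 (A *\<^sub>v v) \<le> spectral_norm A * vec_norm2 v"
proof -
  define S where "S = {vec_norm2 (A *\<^sub>v v) |v. v \<in> carrier_vec (dim_col A) \<and> vec_norm2 v \<le> 1}"
  define F where "F = (\<Sum>i<dim_row A. \<Sum>j<dim_col A. (A $$ (i, j))\<^sup>2)"
  have F: "F \<ge> 0" unfolding F_def by (intro sum_nonneg) auto
  have "vec_norm2 (A *\<^sub>v w) \<le> sqrt F" if "w \<in> carrier_vec (dim_col A)" "vec_norm2 w \<le> 1" for w
  proof (rule real_le_rsqrt)
    have "vec_norm2 (A *\<^sub>v w) ^ 2 \<le> F * vec_norm2 w ^ 2"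
      unfolding F_def by (rule vec_norm2_mult_mat_le) fact
    also have "\<dots> \<le> F * 1"
      using that F vec_norm2_nonneg by (intro mult_left_mono power_le_one) auto
    finally show "vec_norm2 (A *\<^sub>v w) ^ 2 \<le> F" by simp
  qed
  then have bdd: "bdd_above S"
    unfolding S_def by (intro bdd_aboveI[of _ "sqrt F"]) auto
  show ?thesis
  proof (cases "vec_norm2 v = 0")
    case True
    then have "vec_norm2 (A *\<^sub>v v) ^ 2 \<le> 0"
      using vec_norm2_mult_mat_le[OF v] by simp
    then show ?thesis using True by simp
  next
    case False
    define c where "c = vec_norm2 v"
    have c: "c > 0" using False vec_norm2_nonneg[of v] unfolding c_def by simp
    define w where "w = (1 / c) \<cdot>\<^sub>v v"
    have w: "w \<in> carrier_vec (dim_col A)" using v unfolding w_def by simp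
    have "vec_norm2 w = 1"
      unfolding w_def vec_norm2_smult using c by (simp add: c_def[symmetric])
    with w have "vec_norm2 (A *\<^sub>v w) \<in> S" unfolding S_def by auto
    then have *: "vec_norm2 (A *\<^sub>v w) \<le> spectral_norm A"
      unfolding spectral_norm_def S_def[symmetric] by (rule cSup_upper[OF _ bdd])
    have "A *\<^sub>v w = (1 / c) \<cdot>\<^sub>v (A *\<^sub>v v)"
      unfolding w_def using v by (simp add: mult_mat_vec[of A "dim_row A" "dim_col A"])
    then have "vec_norm2 (A *\<^sub>v v) / c \<le> spectral_norm A"
      using * c by (simp add: vec_norm2_smult)
    then show ?thesis
      using c by (simp add: field_simps c_def[symmetric])
  qed
qed

lemma ones_mat_mult_vec:
  assumes "y \<in> carrier_vec n"
  shows "ones_mat n *\<^sub>v y = (\<Sum>i<n. vec_index y i) \<cdot>\<^sub>v ones_vec n"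
  using assms by (intro eq_vecI) (auto simp: ones_mat_def ones_vec_def scalar_prod_def lessThan_atLeast0)

text \<open>
  Columns of sum one keep \<open>W x\<close> in the hyperplane of vectors with zero sum. There \<open>U\<^sup>T\<close> preserves
  norms, because \<open>|U\<^sup>T y|\<^sup>2 = y \<bullet> (U U\<^sup>T y) = |y|\<^sup>2\<close>, so that \<open>|W x| = |U\<^sup>T W U (U\<^sup>T x)|\<close>.
\<close>

lemma mixing_contracts_scalar:
  fixes W U :: "real Matrix.mat" and x :: "nat \<Rightarrow> real"
  assumes W: "W \<in> carrier_mat n n"
    and cols: "\<And>j. j < n \<Longrightarrow> (\<Sum>i<n. W $$ (i, j)) = 1"
    and U: "U \<in> carrier_mat n m"
    and UU: "1\<^sub>m n - (1 / real n) \<cdot>\<^sub>m ones_mat n = U * transpose_mat U"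
    and gap: "spectral_norm (transpose_mat U * W * U) \<le> 1 - \<rho>"
    and sum0: "(\<Sum>j<n. x j) = 0"
  shows "(\<Sum>i<n. (\<Sum>j<n. W $$ (i, j) * x j)\<^sup>2) \<le> (1 - \<rho>)\<^sup>2 * (\<Sum>i<n. (x i)\<^sup>2)"
proof -
  define v where "v = Matrix.vec n x"
  define y where "y = W *\<^sub>v v"
  have v: "v \<in> carrier_vec n" and y: "y \<in> carrier_vec n"
    using W unfolding v_def y_def by auto
  have y_index: "vec_index y i = (\<Sum>j<n. W $$ (i, j) * x j)" if "i < n" for i
    using that W unfolding y_def v_def by (auto simp: scalar_prod_def lessThan_atLeast0)
  have sum_y: "(\<Sum>i<n. vec_index y i) = 0"
  proof -
    have "(\<Sum>i<n. vec_index y i) = (\<Sum>i<n. \<Sum>j<n. W $$ (i, j) * x j)"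
      using y_index by simp
    also have "\<dots> = (\<Sum>j<n. (\<Sum>i<n. W $$ (i, j)) * x j)"
      by (subst sum.swap) (simp add: sum_distrib_right)
    also have "\<dots> = 0" using cols sum0 by simp
    finally show ?thesis .
  qed
  have sum_v: "(\<Sum>i<n. vec_index v i) = 0" using sum0 unfolding v_def by simp
  have Ut: "transpose_mat U \<in> carrier_mat m n" using U by simp
  \<comment> \<open>On vectors with zero sum, the projection \<open>U U\<^sup>T\<close> is the identity and \<open>U\<^sup>T\<close> an isometry.\<close>
  have proj: "U *\<^sub>v (transpose_mat U *\<^sub>v w) = w" if w: "w \<in> carrier_vec n" and w0: "(\<Sum>i<n. vec_index w i) = 0" for w
  proof -
    have "U *\<^sub>v (transpose_mat U *\<^sub>v w) = (1\<^sub>m n - (1 / real n) \<cdot>\<^sub>m ones_mat n) *\<^sub>v w"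
      unfolding UU using U w by (simp add: assoc_mult_mat_vec[OF U Ut w])
    also have "\<dots> = 1\<^sub>m n *\<^sub>v w - ((1 / real n) \<cdot>\<^sub>m ones_mat n) *\<^sub>v w"
      using w by (intro minus_mult_distrib_mat_vec) (auto simp: ones_mat_def)
    also have "((1 / real n) \<cdot>\<^sub>m ones_mat n) *\<^sub>v w = 0\<^sub>v n"
    proof -
      have "((1 / real n) \<cdot>\<^sub>m ones_mat n) *\<^sub>v w = (1 / real n) \<cdot>\<^sub>v (ones_mat n *\<^sub>v w)"
        using w by (intro eq_vecI) (auto simp: ones_mat_def)
      then show ?thesis
        unfolding ones_mat_mult_vec[OF w] w0 by (auto simp: ones_vec_def)
    qed
    finally show ?thesis using w by simp
  qed
  have iso: "vec_norm2 (transpose_mat U *\<^sub>v w) = vec_norm2 w"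
    if w: "w \<in> carrier_vec n" and w0: "(\<Sum>i<n. vec_index w i) = 0" for w
  proof -
    have c: "transpose_mat U *\<^sub>v w \<in> carrier_vec m" using Ut w by auto
    have "scalar_prod (transpose_mat U *\<^sub>v w) (transpose_mat U *\<^sub>v w)
        = scalar_prod w (U *\<^sub>v (transpose_mat U *\<^sub>v w))"
      using transpose_vec_mult_scalar[OF U c w] .
    then show ?thesis unfolding vec_norm2_def proj[OF w w0] by simp
  qed
  define u where "u = transpose_mat U *\<^sub>v v"
  have u: "u \<in> carrier_vec m" using Ut v unfolding u_def by auto
  have "transpose_mat U *\<^sub>v y = transpose_mat U *\<^sub>v (W *\<^sub>v (U *\<^sub>v u))"
    unfolding y_def u_def proj[OF v sum_v] ..
  also have "\<dots> = (transpose_mat U * W * U) *\<^sub>v u"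
    using U W u Ut by (simp add: assoc_mult_mat_vec[of _ m n _ n] assoc_mult_mat_vec[of _ m n _ m])
  finally have "vec_norm2 (transpose_mat U *\<^sub>v y) \<le> spectral_norm (transpose_mat U * W * U) * vec_norm2 u"
    using vec_norm2_mult_mat_spectral[of u "transpose_mat U * W * U"] u U by simp
  also have "\<dots> \<le> (1 - \<rho>) * vec_norm2 u"
    by (intro mult_right_mono gap vec_norm2_nonneg)
  finally have "vec_norm2 y \<le> (1 - \<rho>) * vec_norm2 v"
    unfolding u_def iso[OF v sum_v] iso[OF y sum_y] .
  then have "vec_norm2 y ^ 2 \<le> (1 - \<rho>)\<^sup>2 * vec_norm2 v ^ 2"
    by (metis power_mono vec_norm2_nonneg power_mult_distrib)
  then show ?thesis
    unfolding vec_norm2_power2 using v y y_index by (simp add: v_def)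
qed

text \<open>
  The matrix acts on each coordinate of the agents' vectors separately, and squared norms add up over coordinates.
\<close>

lemma mixing_contracts:
  fixes W U :: "real Matrix.mat" and x :: "nat \<Rightarrow> 'a::euclidean_space"
  assumes W: "W \<in> carrier_mat n n"
    and cols: "\<And>j. j < n \<Longrightarrow> (\<Sum>i<n. W $$ (i, j)) = 1"
    and U: "U \<in> carrier_mat n m"
    and UU: "1\<^sub>m n - (1 / real n) \<cdot>\<^sub>m ones_mat n = U * transpose_mat U"
    and gap: "spectral_norm (transpose_mat U * W * U) \<le> 1 - \<rho>"
    and sum0: "(\<Sum>j<n. x j) = 0"
  shows "(\<Sum>i<n. (norm (\<Sum>j<n. W $$ (i, j) *\<^sub>R x j))\<^sup>2) \<le> (1 - \<rho>)\<^sup>2 * (\<Sum>i<n. (norm (x i))\<^sup>2)"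
proof -
  have nrm: "(norm z)\<^sup>2 = (\<Sum>k\<in>Basis. (inner z k)\<^sup>2)" for z :: 'a
    by (subst power2_norm_eq_inner, subst euclidean_inner) (simp add: power2_eq_square)
  have "(\<Sum>i<n. (norm (\<Sum>j<n. W $$ (i, j) *\<^sub>R x j))\<^sup>2)
      = (\<Sum>k\<in>Basis. \<Sum>i<n. (\<Sum>j<n. W $$ (i, j) * inner (x j) k)\<^sup>2)"
    unfolding nrm by (subst sum.swap) (simp add: inner_sum_left)
  also have "\<dots> \<le> (\<Sum>k\<in>Basis. (1 - \<rho>)\<^sup>2 * (\<Sum>i<n. (inner (x i) k)\<^sup>2))"
  proof (intro sum_mono mixing_contracts_scalar[OF W cols U UU gap])
    fix k :: 'a
    show "(\<Sum>j<n. inner (x j) k) = 0"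
      using sum0 by (simp add: inner_sum_left[symmetric])
  qed
  also have "\<dots> = (1 - \<rho>)\<^sup>2 * (\<Sum>i<n. (norm (x i))\<^sup>2)"
    unfolding nrm by (simp add: sum_distrib_left sum.swap[of _ Basis "{..<n}"])
  finally show ?thesis .
qed

section \<open>Gradients and first-order remainders\<close>

lemma GDERIV_imp_grad: "GDERIV f x :> g \<Longrightarrow> grad f x = g"
  unfolding grad_def
proof (rule the_equality)
  fix g' assume "GDERIV f x :> g" "GDERIV f x :> g'"
  then have "(\<lambda>h. inner h g) = (\<lambda>h. inner h g')"
    unfolding gderiv_def by (rule has_derivative_unique)
  then show "g' = g"
    by (metis inner_commute vector_eq_rdot)
qed

lemma GDERIV_grad:
  fixes f :: "'a::euclidean_space \<Rightarrow> real"
  assumes "f differentiable at x"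
  shows "GDERIV f x :> grad f x"
proof -
  obtain f' where f': "(f has_derivative f') (at x)"
    using assms unfolding differentiable_def by auto
  interpret bounded_linear f' using f' by (rule has_derivative_bounded_linear)
  have "f' = (\<lambda>h. inner h (\<Sum>k\<in>Basis. f' k *\<^sub>R k))"
  proof
    fix h
    have "f' h = f' (\<Sum>k\<in>Basis. inner h k *\<^sub>R k)" by (simp add: euclidean_representation)
    also have "\<dots> = inner h (\<Sum>k\<in>Basis. f' k *\<^sub>R k)"
      by (simp add: sum scaleR inner_sum_right mult.commute)
    finally show "f' h = inner h (\<Sum>k\<in>Basis. f' k *\<^sub>R k)" .
  qed
  with f' have "GDERIV f x :> (\<Sum>k\<in>Basis. f' k *\<^sub>R k)"
    unfolding gderiv_def by simp
  then show ?thesis using GDERIV_imp_grad by metis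
qed

text \<open>
  The mean value inequality on the segment gives the remainder without the customary factor \<open>1/2\<close>. It is
  applied to the objective (whose derivative is the gradient) and to the local gradients (whose derivative is
  the Hessian); the constants of the final bound leave room for the lost factor in both places.
\<close>

lemma taylor1_remainder_le:
  fixes F :: "'a::real_normed_vector \<Rightarrow> 'b::real_normed_vector"
  assumes der: "\<And>u. (F has_derivative F' u) (at u)"
    and lip: "\<And>u. onorm (\<lambda>h. F' u h - F' x h) \<le> K * norm (u - x)"
    and K: "K \<ge> 0"
  shows "norm (F y - F x - F' x (y - x)) \<le> K * (norm (y - x))\<^sup>2"
proof -
  have "norm (F y - F x - F' x (y - x)) \<le> norm (y - x) * (K * norm (y - x))"
  proof (rule differentiable_bound_linearization[where S = "closed_segment x y"])
    show "x + t *\<^sub>R (y - x) \<in> closed_segment x y" if "t \<in> {0..1}" for t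
      using that unfolding closed_segment_def
      by (auto intro!: exI[of _ t] simp: algebra_simps)
    show "(F has_derivative F' u) (at u within closed_segment x y)" for u
      using der by (rule has_derivative_at_withinI)
    show "onorm (F' u - F' x) \<le> K * norm (y - x)" if "u \<in> closed_segment x y" for u
    proof -
      have "onorm (\<lambda>h. F' u h - F' x h) \<le> K * norm (u - x)" by (rule lip)
      also have "\<dots> \<le> K * norm (y - x)"
        using K segment_bound1[OF that] by (rule mult_left_mono[rotated])
      finally show ?thesis by (simp add: fun_diff_def)
    qed
  qed auto
  then show ?thesis by (simp add: power2_eq_square mult_ac)
qed

section \<open>Joint measurability of stochastic gradients\<close>

text \<open>
  The state is approximated by simple functions of itself, so that for each approximation only finitely many
  sections of \<open>g\<close> are involved; continuity in the state passes this to the limit.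
\<close>

lemma borel_measurable_caratheodory:
  fixes g :: "'a::{metric_space, second_countable_topology} \<Rightarrow> 'z \<Rightarrow> 'b::metric_space"
  assumes meas: "\<And>x. g x \<in> borel_measurable Z"
    and cont: "\<And>z. z \<in> space Z \<Longrightarrow> continuous_on UNIV (\<lambda>x. g x z)"
  shows "(\<lambda>p. g (fst p) (snd p)) \<in> borel_measurable (borel \<Otimes>\<^sub>M Z)"
proof -
  obtain s :: "nat \<Rightarrow> 'a \<Rightarrow> 'a" where s: "\<And>i. simple_function borel (s i)"
    and lim: "\<And>x. (\<lambda>i. s i x) \<longlonglongrightarrow> x"
    using borel_measurable_implies_sequence_metric[of "\<lambda>x::'a. x" borel undefined]
    by (auto simp: choice_iff)
  show ?thesis
  proof (rule borel_measurable_LIMSEQ_metric)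
    fix i
    have fin: "finite (range (s i))" using simple_functionD(1)[OF s[of i]] by simp
    show "(\<lambda>p. g (s i (fst p)) (snd p)) \<in> borel_measurable (borel \<Otimes>\<^sub>M Z)"
    proof (rule measurable_compose_countable'[where I = "range (s i)" and f = "\<lambda>a p. g a (snd p)"
          and g = "\<lambda>p. s i (fst p)"])
      show "(\<lambda>p. g a (snd p)) \<in> borel_measurable (borel \<Otimes>\<^sub>M Z)" for a
        using meas[of a] by measurable
      have "s i \<in> measurable borel (count_space (range (s i)))"
        using simple_functionD(2)[OF s[of i]] fin by (subst measurable_count_space_eq2) auto
      then show "(\<lambda>p. s i (fst p)) \<in> measurable (borel \<Otimes>\<^sub>M Z) (count_space (range (s i)))"
        by (rule measurable_compose[OF measurable_fst])
    qed (use fin in \<open>simp add: countable_finite\<close>)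
  next
    fix p assume "p \<in> space ((borel :: 'a measure) \<Otimes>\<^sub>M Z)"
    then have "isCont (\<lambda>x. g x (snd p)) (fst p)"
      using cont[of "snd p"] by (auto simp: space_pair_measure continuous_on_eq_continuous_at)
    then show "(\<lambda>i. g (s i (fst p)) (snd p)) \<longlonglongrightarrow> g (fst p) (snd p)"
      by (rule isCont_tendsto_compose[OF _ lim])
  qed
qed

lemma GDERIV_directional_LIMSEQ:
  assumes "GDERIV f x :> g"
  shows "(\<lambda>m. (f (x + inverse (real (Suc m)) *\<^sub>R k) - f x) / inverse (real (Suc m))) \<longlonglongrightarrow> inner g k"
proof -
  have f': "(f has_derivative (\<lambda>h. inner h g)) (at (x + 0 *\<^sub>R k))"
    using assms unfolding gderiv_def by simp
  have "((\<lambda>t. x + t *\<^sub>R k) has_derivative (\<lambda>t. t *\<^sub>R k)) (at 0)"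
    by (auto intro!: derivative_eq_intros)
  from has_derivative_compose[OF this f']
  have "((\<lambda>t. f (x + t *\<^sub>R k)) has_derivative (\<lambda>t. inner (t *\<^sub>R k) g)) (at 0)" .
  then have "DERIV (\<lambda>t. f (x + t *\<^sub>R k)) 0 :> inner g k"
    by (simp add: has_field_derivative_def mult.commute inner_commute[of g k])
       (simp add: mult_commute_abs)
  then have "((\<lambda>h. (f (x + h *\<^sub>R k) - f x) / h) \<longlongrightarrow> inner g k) (at 0)"
    by (auto dest!: DERIV_D)
  moreover have "filterlim (\<lambda>m. inverse (real (Suc m))) (at 0) sequentially"
    by (rule filterlim_atI[OF LIMSEQ_inverse_real_of_nat]) auto
  ultimately show ?thesis by (rule filterlim_compose)
qed

text \<open>
  The algorithm evaluates the stochastic gradient at a random point and a random sample, so measurability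
  in the sample alone is not enough. The loss is a Caratheodory function, and the components
  of its gradient are pointwise limits of difference quotients.
\<close>

lemma grad_loss_measurable:
  fixes l :: "'a::euclidean_space \<Rightarrow> 'z \<Rightarrow> real"
  assumes meas: "\<And>x. l x \<in> borel_measurable Z"
    and diff: "\<And>z x. z \<in> space Z \<Longrightarrow> (\<lambda>y. l y z) differentiable at x"
  shows "(\<lambda>p. grad_loss l (fst p) (snd p)) \<in> borel_measurable (borel \<Otimes>\<^sub>M Z)"
proof -
  have l: "(\<lambda>p. l (fst p) (snd p)) \<in> borel_measurable (borel \<Otimes>\<^sub>M Z)"
    by (rule borel_measurable_caratheodory[OF meas])
       (auto intro!: differentiable_imp_continuous_on diff simp: differentiable_on_def)
  have shift: "(\<lambda>p. l (fst p + v) (snd p)) \<in> borel_measurable (borel \<Otimes>\<^sub>M Z)" for v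
  proof -
    have "(\<lambda>p. (fst p + v, snd p)) \<in> measurable (borel \<Otimes>\<^sub>M Z) (borel \<Otimes>\<^sub>M Z)" by measurable
    from measurable_compose[OF this l] show ?thesis by simp
  qed
  have "(\<lambda>p. inner (grad_loss l (fst p) (snd p)) k) \<in> borel_measurable (borel \<Otimes>\<^sub>M Z)" for k
  proof (rule borel_measurable_LIMSEQ_metric)
    fix m
    show "(\<lambda>p. (l (fst p + inverse (real (Suc m)) *\<^sub>R k) (snd p) - l (fst p) (snd p)) / inverse (real (Suc m)))
        \<in> borel_measurable (borel \<Otimes>\<^sub>M Z)"
      by (intro borel_measurable_divide borel_measurable_diff shift l) simp
  next
    fix p assume "p \<in> space ((borel :: 'a measure) \<Otimes>\<^sub>M Z)"
    then have z: "snd p \<in> space Z" by (auto simp: space_pair_measure)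
    show "(\<lambda>m. (l (fst p + inverse (real (Suc m)) *\<^sub>R k) (snd p) - l (fst p) (snd p)) / inverse (real (Suc m)))
        \<longlonglongrightarrow> inner (grad_loss l (fst p) (snd p)) k"
      unfolding grad_loss_def by (rule GDERIV_directional_LIMSEQ[OF GDERIV_grad[OF diff[OF z]]])
  qed
  then show ?thesis by (subst borel_measurable_euclidean_space) blast
qed

section \<open>Integrating out an independent variable\<close>

text \<open>
  Independence enters in the form "the joint law is the product of the marginal laws", which allows \<open>Y\<close> and \<open>X\<close> to
  take values in different types. By Fubini, a bound for \<open>X\<close> at every fixed value of \<open>Y\<close> then survives
  averaging over \<open>Y\<close>. This and the next lemma replace conditional expectations throughout.
\<close>

lemma (in prob_space) product_distr_nn_integral_le:
  assumes Y: "random_variable S Y" and X: "random_variable N X"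
    and eq: "distr M S Y \<Otimes>\<^sub>M distr M N X = distr M (S \<Otimes>\<^sub>M N) (\<lambda>\<omega>. (Y \<omega>, X \<omega>))"
    and h: "h \<in> borel_measurable (S \<Otimes>\<^sub>M N)"
    and le: "\<And>y. y \<in> space S \<Longrightarrow> (\<integral>\<^sup>+z. h (y, z) \<partial>distr M N X) \<le> c"
  shows "(\<integral>\<^sup>+\<omega>. h (Y \<omega>, X \<omega>) \<partial>M) \<le> c"
proof -
  interpret Y: prob_space "distr M S Y" by (rule prob_space_distr[OF Y])
  interpret X: prob_space "distr M N X" by (rule prob_space_distr[OF X])
  have "(\<integral>\<^sup>+\<omega>. h (Y \<omega>, X \<omega>) \<partial>M) = (\<integral>\<^sup>+p. h p \<partial>(distr M S Y \<Otimes>\<^sub>M distr M N X))"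
    unfolding eq using X Y h by (subst nn_integral_distr) auto
  also have "\<dots> = (\<integral>\<^sup>+y. \<integral>\<^sup>+z. h (y, z) \<partial>distr M N X \<partial>distr M S Y)"
    using h by (subst X.nn_integral_fst[symmetric]) (auto cong: measurable_cong_sets sets_pair_measure_cong)
  also have "\<dots> \<le> (\<integral>\<^sup>+y. c \<partial>distr M S Y)"
    by (intro nn_integral_mono le) simp
  also have "\<dots> = c" using Y.emeasure_space_1 by simp
  finally show ?thesis .
qed

lemma (in prob_space) product_distr_expectation_zero:
  fixes h :: "_ \<Rightarrow> real"
  assumes Y: "random_variable S Y" and X: "random_variable N X"
    and eq: "distr M S Y \<Otimes>\<^sub>M distr M N X = distr M (S \<Otimes>\<^sub>M N) (\<lambda>\<omega>. (Y \<omega>, X \<omega>))"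
    and h: "h \<in> borel_measurable (S \<Otimes>\<^sub>M N)"
    and int: "integrable M (\<lambda>\<omega>. h (Y \<omega>, X \<omega>))"
    and zero: "\<And>y. y \<in> space S \<Longrightarrow> (\<integral>z. h (y, z) \<partial>distr M N X) = 0"
  shows "expectation (\<lambda>\<omega>. h (Y \<omega>, X \<omega>)) = 0"
proof -
  interpret Y: prob_space "distr M S Y" by (rule prob_space_distr[OF Y])
  interpret X: prob_space "distr M N X" by (rule prob_space_distr[OF X])
  interpret pair_sigma_finite "distr M S Y" "distr M N X" ..
  have YX: "(\<lambda>\<omega>. (Y \<omega>, X \<omega>)) \<in> measurable M (S \<Otimes>\<^sub>M N)" using X Y by measurable
  have "expectation (\<lambda>\<omega>. h (Y \<omega>, X \<omega>)) = (\<integral>p. h p \<partial>(distr M S Y \<Otimes>\<^sub>M distr M N X))"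
    unfolding eq by (subst integral_distr[OF YX h]) simp
  also have "\<dots> = (\<integral>y. \<integral>z. h (y, z) \<partial>distr M N X \<partial>distr M S Y)"
  proof (rule integral_fst'[symmetric])
    show "integrable (distr M S Y \<Otimes>\<^sub>M distr M N X) h"
      unfolding eq using int by (subst integrable_distr_eq[OF YX h])
  qed
  also have "\<dots> = (\<integral>y. 0 \<partial>distr M S Y)"
    by (intro Bochner_Integration.integral_cong) (auto simp: zero)
  finally show ?thesis by simp
qed

section \<open>Averages and stacked vectors\<close>

lemma sum_diff_avg: "n \<ge> 1 \<Longrightarrow> (\<Sum>i<n. x i - avg n x) = 0"
  by (simp add: avg_def sum_subtractf scaleR_conv_of_real sum_constant_scaleR)

lemma avg_add: "avg n (\<lambda>i. x i + y i) = avg n x + avg n y"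
  by (simp add: avg_def sum.distrib scaleR_add_right)

lemma avg_diff: "avg n (\<lambda>i. x i - y i) = avg n x - avg n y"
  by (simp add: avg_def sum_subtractf scaleR_diff_right)

lemma avg_scaleR: "avg n (\<lambda>i. c *\<^sub>R x i) = c *\<^sub>R avg n x"
  by (simp add: avg_def scaleR_sum_right mult.commute)

lemma avg_const: "n \<ge> 1 \<Longrightarrow> avg n (\<lambda>i. c) = c"
  by (simp add: avg_def sum_constant_scaleR)

lemma norm_avg_le: "norm (avg n x) \<le> (\<Sum>i<n. norm (x i)) / real n"
  by (simp add: avg_def divide_right_mono norm_sum)

lemma sum_norm_diff_avg:
  fixes x :: "nat \<Rightarrow> 'a::real_inner"
  assumes "n \<ge> 1"
  shows "(\<Sum>i<n. (norm (x i - c))\<^sup>2) = (\<Sum>i<n. (norm (x i - avg n x))\<^sup>2) + real n * (norm (avg n x - c))\<^sup>2"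
proof -
  have "(norm (x i - c))\<^sup>2 = (norm (x i - avg n x))\<^sup>2
      + 2 * inner (x i - avg n x) (avg n x - c) + (norm (avg n x - c))\<^sup>2" for i
    by (simp add: power2_norm_eq_inner inner_diff_left inner_diff_right inner_commute)
  then have "(\<Sum>i<n. (norm (x i - c))\<^sup>2) = (\<Sum>i<n. (norm (x i - avg n x))\<^sup>2)
      + 2 * inner (\<Sum>i<n. x i - avg n x) (avg n x - c) + real n * (norm (avg n x - c))\<^sup>2"
    by (simp add: sum.distrib inner_sum_left sum_distrib_left)
  then show ?thesis unfolding sum_diff_avg[OF assms] by simp
qed

lemma sum_norm_diff_avg_le:
  fixes x :: "nat \<Rightarrow> 'a::real_inner"
  assumes "n \<ge> 1"
  shows "(\<Sum>i<n. (norm (x i - avg n x))\<^sup>2) \<le> (\<Sum>i<n. (norm (x i - c))\<^sup>2)"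
  unfolding sum_norm_diff_avg[OF assms, of x c] by simp

text \<open>
  Convexity, since \<open>(1 - \<kappa>) a + y\<close> is the convex combination \<open>(1 - \<kappa>) a + \<kappa> (y / \<kappa>)\<close>.
\<close>

lemma contraction_power2_le:
  fixes a y \<kappa> :: real
  assumes "0 < \<kappa>" "\<kappa> \<le> 1"
  shows "((1 - \<kappa>) * a + y)\<^sup>2 \<le> (1 - \<kappa>) * a\<^sup>2 + y\<^sup>2 / \<kappa>"
proof -
  have "(1 - \<kappa>) * a\<^sup>2 + y\<^sup>2 / \<kappa> - ((1 - \<kappa>) * a + y)\<^sup>2 = \<kappa> * (1 - \<kappa>) * (a - y / \<kappa>)\<^sup>2"
    using assms by (simp add: field_simps power2_eq_square)
  also have "\<dots> \<ge> 0" using assms by simp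
  finally show ?thesis by simp
qed

lemma contraction_power4_le:
  fixes a y \<kappa> :: real
  assumes "0 < \<kappa>" "\<kappa> \<le> 1"
  shows "((1 - \<kappa>) * a + y) ^ 4 \<le> (1 - \<kappa>) * a ^ 4 + y ^ 4 / \<kappa> ^ 3"
proof -
  have "((1 - \<kappa>) * a + y) ^ 4 = (((1 - \<kappa>) * a + y)\<^sup>2)\<^sup>2" by simp
  also have "\<dots> \<le> ((1 - \<kappa>) * a\<^sup>2 + y\<^sup>2 / \<kappa>)\<^sup>2"
    by (intro power_mono contraction_power2_le assms) simp
  also have "\<dots> \<le> (1 - \<kappa>) * (a\<^sup>2)\<^sup>2 + (y\<^sup>2 / \<kappa>)\<^sup>2 / \<kappa>"
    by (rule contraction_power2_le assms)+
  also have "\<dots> = (1 - \<kappa>) * a ^ 4 + y ^ 4 / \<kappa> ^ 3"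
    by (simp add: power_divide power2_eq_square power4_eq_xxxx power3_eq_cube mult_ac)
  finally show ?thesis .
qed

text \<open>
  The Euclidean norm of the concatenation of \<open>x 0, \<dots>, x (n - 1)\<close>, equivalently the Frobenius norm
  of the matrix with these rows.
\<close>

definition stack_norm :: "nat \<Rightarrow> (nat \<Rightarrow> 'a::real_normed_vector) \<Rightarrow> real" where
  "stack_norm n x = L2_set (\<lambda>i. norm (x i)) {..<n}"

lemma stack_norm_nonneg: "stack_norm n x \<ge> 0"
  by (simp add: stack_norm_def L2_set_nonneg)

lemma stack_norm_power2: "(stack_norm n x)\<^sup>2 = (\<Sum>i<n. (norm (x i))\<^sup>2)"
  by (simp add: stack_norm_def L2_set_def sum_nonneg)

lemma stack_norm_power4: "stack_norm n x ^ 4 = (\<Sum>i<n. (norm (x i))\<^sup>2)\<^sup>2"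
  unfolding stack_norm_power2[symmetric] by simp

lemma stack_norm_triangle: "stack_norm n (\<lambda>i. x i + y i) \<le> stack_norm n x + stack_norm n y"
proof -
  have "stack_norm n (\<lambda>i. x i + y i) \<le> L2_set (\<lambda>i. norm (x i) + norm (y i)) {..<n}"
    unfolding stack_norm_def by (intro L2_set_mono norm_triangle_ineq) auto
  also have "\<dots> \<le> stack_norm n x + stack_norm n y"
    unfolding stack_norm_def by (rule L2_set_triangle_ineq)
  finally show ?thesis .
qed

lemma stack_norm_scaleR: "stack_norm n (\<lambda>i. c *\<^sub>R x i) = \<bar>c\<bar> * stack_norm n x"
  by (simp add: stack_norm_def L2_set_right_distrib)

lemma norm_le_stack_norm: "i < n \<Longrightarrow> norm (x i) \<le> stack_norm n x"
  unfolding stack_norm_def by (rule member_le_L2_set) auto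

lemma sum_norm_le_stack_norm: "(\<Sum>i<n. norm (x i)) \<le> sqrt (real n) * stack_norm n x"
  using L2_set_mult_ineq[of "\<lambda>_. 1" "\<lambda>i. norm (x i)" "{..<n}"]
  by (simp add: stack_norm_def L2_set_constant)

lemma power4_stack_norm_le: "stack_norm n x ^ 4 \<le> real n * (\<Sum>i<n. norm (x i) ^ 4)"
proof -
  have "(\<Sum>i<n. 1 * (norm (x i))\<^sup>2)\<^sup>2 \<le> (\<Sum>i<n. 1\<^sup>2) * (\<Sum>i<n. ((norm (x i))\<^sup>2)\<^sup>2)"
    by (rule Cauchy_Schwarz_ineq_sum)
  then show ?thesis unfolding stack_norm_power4 by simp
qed

lemma sum_inner_le_stack_norm:
  fixes x y :: "nat \<Rightarrow> 'a::real_inner"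
  shows "\<bar>\<Sum>i<n. inner (x i) (y i)\<bar> \<le> stack_norm n x * stack_norm n y"
proof -
  have "\<bar>\<Sum>i<n. inner (x i) (y i)\<bar> \<le> (\<Sum>i<n. \<bar>norm (x i)\<bar> * \<bar>norm (y i)\<bar>)"
    by (rule order_trans[OF sum_abs]) (auto intro!: sum_mono Cauchy_Schwarz_ineq2)
  also have "\<dots> \<le> stack_norm n x * stack_norm n y"
    unfolding stack_norm_def by (rule L2_set_mult_ineq)
  finally show ?thesis .
qed

section \<open>Random vectors with finite fourth moment\<close>

lemma power4_add_le:
  fixes a b :: real
  shows "(a + b) ^ 4 \<le> 8 * (a ^ 4 + b ^ 4)"
proof -
  have sq: "(u + v)\<^sup>2 \<le> 2 * (u\<^sup>2 + v\<^sup>2)" for u v :: real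
    using zero_le_power2[of "u - v"] by (simp add: power2_eq_square algebra_simps)
  have "(a + b) ^ 4 = ((a + b)\<^sup>2)\<^sup>2" by simp
  also have "\<dots> \<le> (2 * (a\<^sup>2 + b\<^sup>2))\<^sup>2" by (intro power_mono sq) simp
  also have "\<dots> = 4 * (a\<^sup>2 + b\<^sup>2)\<^sup>2" by (simp only: power_mult_distrib) simp
  also have "\<dots> \<le> 4 * (2 * ((a\<^sup>2)\<^sup>2 + (b\<^sup>2)\<^sup>2))" by (intro mult_left_mono sq) simp
  finally show ?thesis by simp
qed

lemma power3_mult_le:
  fixes a b :: real
  assumes "a \<ge> 0" "b \<ge> 0"
  shows "a ^ 3 * b \<le> a ^ 4 + b ^ 4"
proof (cases "a \<le> b")
  case True
  then have "a ^ 3 * b \<le> b ^ 3 * b"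
    using assms by (intro mult_right_mono power_mono) auto
  also have "\<dots> \<le> a ^ 4 + b ^ 4" using assms by (simp add: eval_nat_numeral)
  finally show ?thesis .
next
  case False
  then have "a ^ 3 * b \<le> a ^ 3 * a"
    using assms by (intro mult_left_mono) auto
  also have "\<dots> \<le> a ^ 4 + b ^ 4" using assms by (simp add: eval_nat_numeral)
  finally show ?thesis .
qed

lemma power2_le_one_power4: "(a::real)\<^sup>2 \<le> 1 + a ^ 4"
proof -
  have "0 \<le> (a\<^sup>2 - 1)\<^sup>2 + a\<^sup>2 * a\<^sup>2 + 1" by (intro add_nonneg_nonneg) auto
  then have "2 * a\<^sup>2 \<le> 2 + 2 * a ^ 4" by (simp add: power2_eq_square power4_eq_xxxx algebra_simps)
  then show ?thesis by simp
qed

context prob_space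
begin

text \<open>
  All random vectors of the algorithm belong to this class. It is closed under linear combinations and
  Lipschitz maps and makes every product of total degree at most four integrable, which settles
  integrability everywhere below.
\<close>

definition has_fourth_moment :: "('a \<Rightarrow> 'b::euclidean_space) \<Rightarrow> bool" where
  "has_fourth_moment X \<longleftrightarrow> X \<in> borel_measurable M \<and> integrable M (\<lambda>\<omega>. norm (X \<omega>) ^ 4)"

lemma has_fourth_moment_measurable: "has_fourth_moment X \<Longrightarrow> X \<in> borel_measurable M"
  by (simp add: has_fourth_moment_def)

lemma has_fourth_moment_integrable: "has_fourth_moment X \<Longrightarrow> integrable M (\<lambda>\<omega>. norm (X \<omega>) ^ 4)"
  by (simp add: has_fourth_moment_def)

lemma has_fourth_moment_const: "has_fourth_moment (\<lambda>_. c)"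
  by (simp add: has_fourth_moment_def)

lemma has_fourth_moment_le:
  assumes X: "has_fourth_moment X" and Y: "Y \<in> borel_measurable M"
    and le: "\<And>\<omega>. norm (Y \<omega>) \<le> norm (X \<omega>)"
  shows "has_fourth_moment Y"
  unfolding has_fourth_moment_def
proof (intro conjI Y)
  show "integrable M (\<lambda>\<omega>. norm (Y \<omega>) ^ 4)"
  proof (rule Bochner_Integration.integrable_bound[OF has_fourth_moment_integrable[OF X]])
    have "norm (Y \<omega>) ^ 4 \<le> norm (X \<omega>) ^ 4" for \<omega>
      by (rule power_mono[OF le norm_ge_zero])
    then show "AE \<omega> in M. norm (norm (Y \<omega>) ^ 4) \<le> norm (norm (X \<omega>) ^ 4)" by simp
  qed (use Y in measurable)
qed

lemma has_fourth_moment_norm: "has_fourth_moment X \<Longrightarrow> has_fourth_moment (\<lambda>\<omega>. norm (X \<omega>))"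
  by (auto simp: has_fourth_moment_def)

lemma has_fourth_moment_add:
  assumes X: "has_fourth_moment X" and Y: "has_fourth_moment Y"
  shows "has_fourth_moment (\<lambda>\<omega>. X \<omega> + Y \<omega>)"
  unfolding has_fourth_moment_def
proof
  note [measurable] = has_fourth_moment_measurable[OF X] has_fourth_moment_measurable[OF Y]
  show "(\<lambda>\<omega>. X \<omega> + Y \<omega>) \<in> borel_measurable M" by measurable
  have "norm (X \<omega> + Y \<omega>) ^ 4 \<le> 8 * (norm (X \<omega>) ^ 4 + norm (Y \<omega>) ^ 4)" for \<omega>
    by (rule order_trans[OF power_mono[OF norm_triangle_ineq] power4_add_le]) simp
  then have bound: "AE \<omega> in M. norm (norm (X \<omega> + Y \<omega>) ^ 4) \<le> norm (8 * (norm (X \<omega>) ^ 4 + norm (Y \<omega>) ^ 4))"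
    by (intro AE_I2) simp
  show "integrable M (\<lambda>\<omega>. norm (X \<omega> + Y \<omega>) ^ 4)"
    by (rule Bochner_Integration.integrable_bound[OF _ _ bound])
      (use has_fourth_moment_integrable[OF X] has_fourth_moment_integrable[OF Y] in \<open>simp, measurable\<close>)
qed

lemma has_fourth_moment_scaleR:
  "has_fourth_moment X \<Longrightarrow> has_fourth_moment (\<lambda>\<omega>. c *\<^sub>R X \<omega>)"
  by (auto simp: has_fourth_moment_def power_mult_distrib)

lemma has_fourth_moment_diff:
  "has_fourth_moment X \<Longrightarrow> has_fourth_moment Y \<Longrightarrow> has_fourth_moment (\<lambda>\<omega>. X \<omega> - Y \<omega>)"
  by (rule has_fourth_moment_add[of X "\<lambda>\<omega>. (-1) *\<^sub>R Y \<omega>", simplified scaleR_minus1_left add_uminus_conv_diff])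
    (use has_fourth_moment_scaleR[of Y "-1"] in \<open>simp_all\<close>)

lemma has_fourth_moment_sum:
  "(\<And>i. i \<in> A \<Longrightarrow> has_fourth_moment (X i)) \<Longrightarrow> has_fourth_moment (\<lambda>\<omega>. \<Sum>i\<in>A. X i \<omega>)"
  by (induction A rule: infinite_finite_induct)
     (simp_all add: has_fourth_moment_const has_fourth_moment_add)

lemma has_fourth_moment_avg:
  "(\<And>i. i < n \<Longrightarrow> has_fourth_moment (\<lambda>\<omega>. X \<omega> i)) \<Longrightarrow> has_fourth_moment (\<lambda>\<omega>. avg n (X \<omega>))"
  unfolding avg_def by (intro has_fourth_moment_scaleR has_fourth_moment_sum) auto

lemma stack_norm_measurable:
  fixes X :: "'b \<Rightarrow> nat \<Rightarrow> 'c::euclidean_space"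
  assumes "\<And>i. i < n \<Longrightarrow> (\<lambda>\<omega>. X \<omega> i) \<in> borel_measurable N"
  shows "(\<lambda>\<omega>. stack_norm n (X \<omega>)) \<in> borel_measurable N"
proof -
  have "(\<lambda>\<omega>. (norm (X \<omega> i))\<^sup>2) \<in> borel_measurable N" if "i < n" for i
    using assms[OF that] by measurable
  then have "(\<lambda>\<omega>. \<Sum>i<n. (norm (X \<omega> i))\<^sup>2) \<in> borel_measurable N"
    by (intro borel_measurable_sum) auto
  then show ?thesis unfolding stack_norm_def L2_set_def by measurable
qed

lemma has_fourth_moment_stack_norm:
  assumes X: "\<And>i. i < n \<Longrightarrow> has_fourth_moment (\<lambda>\<omega>. X \<omega> i)"
  shows "has_fourth_moment (\<lambda>\<omega>. stack_norm n (X \<omega>))"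
  unfolding has_fourth_moment_def
proof
  show m: "(\<lambda>\<omega>. stack_norm n (X \<omega>)) \<in> borel_measurable M"
    by (intro stack_norm_measurable has_fourth_moment_measurable X)
  show "integrable M (\<lambda>\<omega>. norm (stack_norm n (X \<omega>)) ^ 4)"
  proof (rule Bochner_Integration.integrable_bound)
    show "integrable M (\<lambda>\<omega>. real n * (\<Sum>i<n. norm (X \<omega> i) ^ 4))"
      using X by (intro integrable_mult_right Bochner_Integration.integrable_sum)
        (simp add: has_fourth_moment_integrable)
    show "AE \<omega> in M. norm (norm (stack_norm n (X \<omega>)) ^ 4) \<le> norm (real n * (\<Sum>i<n. norm (X \<omega> i) ^ 4))"
      using power4_stack_norm_le by (intro AE_I2) (simp add: stack_norm_nonneg sum_nonneg)
  qed (use m in measurable)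
qed

lemma has_fourth_moment_lipschitz:
  assumes X: "has_fourth_moment X"
    and lip: "\<And>x y. norm (g y - g x) \<le> K * norm (y - x)" and K: "K \<ge> 0"
    and g: "g \<in> borel_measurable borel"
  shows "has_fourth_moment (\<lambda>\<omega>. g (X \<omega>))"
proof (rule has_fourth_moment_le)
  show "has_fourth_moment (\<lambda>\<omega>. norm (g 0) + K *\<^sub>R norm (X \<omega>))"
    by (intro has_fourth_moment_add has_fourth_moment_const has_fourth_moment_scaleR
        has_fourth_moment_norm X)
  show "(\<lambda>\<omega>. g (X \<omega>)) \<in> borel_measurable M"
    by (rule measurable_compose[OF has_fourth_moment_measurable[OF X] g])
  show "norm (g (X \<omega>)) \<le> norm (norm (g 0) + K *\<^sub>R norm (X \<omega>))" for \<omega>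
    using lip[of "X \<omega>" 0] norm_triangle_sub[of "g (X \<omega>)" "g 0"] K by simp
qed

lemma has_fourth_moment_integrable_norm_power2:
  assumes X: "has_fourth_moment X"
  shows "integrable M (\<lambda>\<omega>. (norm (X \<omega>))\<^sup>2)"
proof (rule Bochner_Integration.integrable_bound)
  show "integrable M (\<lambda>\<omega>. 1 + norm (X \<omega>) ^ 4)"
    using has_fourth_moment_integrable[OF X] by simp
  show "AE \<omega> in M. norm ((norm (X \<omega>))\<^sup>2) \<le> norm (1 + norm (X \<omega>) ^ 4)"
    using power2_le_one_power4 by (intro AE_I2) simp
qed (use has_fourth_moment_measurable[OF X] in measurable)

lemma has_fourth_moment_integrable_norm_mult:
  assumes X: "has_fourth_moment X" and Y: "has_fourth_moment Y"
  shows "integrable M (\<lambda>\<omega>. norm (X \<omega>) * norm (Y \<omega>))"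
proof (rule Bochner_Integration.integrable_bound)
  show "integrable M (\<lambda>\<omega>. (norm (X \<omega>))\<^sup>2 + (norm (Y \<omega>))\<^sup>2)"
    by (intro Bochner_Integration.integrable_add has_fourth_moment_integrable_norm_power2 X Y)
  have "norm (X \<omega>) * norm (Y \<omega>) \<le> (norm (X \<omega>))\<^sup>2 + (norm (Y \<omega>))\<^sup>2" for \<omega>
    using sum_squares_bound[of "norm (X \<omega>)" "norm (Y \<omega>)"]
      mult_nonneg_nonneg[OF norm_ge_zero norm_ge_zero, of "X \<omega>" "Y \<omega>"] by linarith
  then show "AE \<omega> in M. norm (norm (X \<omega>) * norm (Y \<omega>)) \<le> norm ((norm (X \<omega>))\<^sup>2 + (norm (Y \<omega>))\<^sup>2)"
    by simp
qed (use has_fourth_moment_measurable[OF X] has_fourth_moment_measurable[OF Y] in measurable)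

lemma has_fourth_moment_integrable_inner:
  assumes X: "has_fourth_moment X" and Y: "has_fourth_moment Y"
  shows "integrable M (\<lambda>\<omega>. inner (X \<omega>) (Y \<omega>))"
proof (rule Bochner_Integration.integrable_bound[OF has_fourth_moment_integrable_norm_mult[OF X Y]])
  show "AE \<omega> in M. norm (inner (X \<omega>) (Y \<omega>)) \<le> norm (norm (X \<omega>) * norm (Y \<omega>))"
    by (intro AE_I2) (simp add: Cauchy_Schwarz_ineq2)
qed (use has_fourth_moment_measurable[OF X] has_fourth_moment_measurable[OF Y] in measurable)

lemma has_fourth_moment_integrable_power3_mult:
  assumes X: "has_fourth_moment X" and Y: "has_fourth_moment Y"
  shows "integrable M (\<lambda>\<omega>. norm (X \<omega>) ^ 3 * norm (Y \<omega>))"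
proof (rule Bochner_Integration.integrable_bound)
  show "integrable M (\<lambda>\<omega>. norm (X \<omega>) ^ 4 + norm (Y \<omega>) ^ 4)"
    using has_fourth_moment_integrable[OF X] has_fourth_moment_integrable[OF Y] by simp
  show "AE \<omega> in M. norm (norm (X \<omega>) ^ 3 * norm (Y \<omega>)) \<le> norm (norm (X \<omega>) ^ 4 + norm (Y \<omega>) ^ 4)"
    by (intro AE_I2) (simp add: power3_mult_le)
qed (use has_fourth_moment_measurable[OF X] has_fourth_moment_measurable[OF Y] in measurable)

end

section \<open>Iterates, histories and noise\<close>

text \<open>
  The field \<open>F i\<close> stands for the gradient of the local objective of agent \<open>i\<close>; it enters as the
  Lipschitz mean of the stochastic gradient.
\<close>

locale dsgd_process = prob_space M for M :: "'w measure" +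
  fixes n :: nat and Z :: "'z measure" and B :: "nat \<Rightarrow> 'z measure"
    and l :: "'a::euclidean_space \<Rightarrow> 'z \<Rightarrow> real" and F :: "nat \<Rightarrow> 'a \<Rightarrow> 'a"
    and W :: "real Matrix.mat" and \<zeta> :: "nat \<Rightarrow> nat \<Rightarrow> 'w \<Rightarrow> 'z"
    and \<gamma> :: "nat \<Rightarrow> real" and \<theta>0 :: "nat \<Rightarrow> 'a" and L \<sigma> :: real
  assumes n: "n \<ge> 1"
    and grad_meas: "(\<lambda>p. grad_loss l (fst p) (snd p)) \<in> borel_measurable (borel \<Otimes>\<^sub>M Z)"
    and indep: "indep_vars (\<lambda>_. Z) (\<lambda>(i, t). \<zeta> i t) ({..<n} \<times> {1..})"
    and distr: "\<And>i t. i < n \<Longrightarrow> t \<ge> 1 \<Longrightarrow> distr M Z (\<zeta> i t) = B i"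
    and L: "L \<ge> 0"
    and F_lipschitz: "\<And>i x y. i < n \<Longrightarrow> norm (F i y - F i x) \<le> L * norm (y - x)"
    and unbiased: "\<And>i x. i < n \<Longrightarrow> has_bochner_integral (B i) (grad_loss l x) (F i x)"
    and moment2: "\<And>i x. i < n \<Longrightarrow> integrable (B i) (\<lambda>z. norm (grad_loss l x z - F i x) ^ 2)"
      "\<And>i x. i < n \<Longrightarrow> (\<integral>z. norm (grad_loss l x z - F i x) ^ 2 \<partial>B i) \<le> \<sigma> ^ 2"
    and moment4: "\<And>i x. i < n \<Longrightarrow> integrable (B i) (\<lambda>z. norm (grad_loss l x z - F i x) ^ 4)"
      "\<And>i x. i < n \<Longrightarrow> (\<integral>z. norm (grad_loss l x z - F i x) ^ 4 \<partial>B i) \<le> \<sigma> ^ 4"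
    and row_sums: "\<And>i. i < n \<Longrightarrow> (\<Sum>j<n. W $$ (i, j)) = 1"
    and column_sums: "\<And>j. j < n \<Longrightarrow> (\<Sum>i<n. W $$ (i, j)) = 1"
begin

definition iterate :: "nat \<Rightarrow> 'w \<Rightarrow> nat \<Rightarrow> 'a" where
  "iterate t \<omega> = dsgd n W \<gamma> l \<theta>0 (\<lambda>i s. \<zeta> i s \<omega>) t"

definition mean_iterate :: "nat \<Rightarrow> 'w \<Rightarrow> 'a" where
  "mean_iterate t \<omega> = avg n (iterate t \<omega>)"

definition local_grad :: "nat \<Rightarrow> 'w \<Rightarrow> nat \<Rightarrow> 'a" where
  "local_grad t \<omega> i = F i (iterate t \<omega> i)"

definition noise :: "nat \<Rightarrow> 'w \<Rightarrow> nat \<Rightarrow> 'a" where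
  "noise t \<omega> i = grad_loss l (iterate t \<omega> i) (\<zeta> i (Suc t) \<omega>) - local_grad t \<omega> i"

text \<open>
  The sigma-algebra of the samples with index in \<open>J\<close>. Measurability with respect to it expresses that a
  quantity is a function of these samples only.
\<close>

definition history :: "(nat \<times> nat) set \<Rightarrow> 'w measure" where
  "history J = vimage_algebra (space M) (\<lambda>\<omega>. \<lambda>k\<in>J. (case k of (i, t) \<Rightarrow> \<zeta> i t) \<omega>) (PiM J (\<lambda>_. Z))"

lemma iterate_Suc:
  "iterate (Suc t) \<omega> i = (\<Sum>j<n. W $$ (i, j) *\<^sub>R iterate t \<omega> j)
     - \<gamma> (Suc t) *\<^sub>R (local_grad t \<omega> i + noise t \<omega> i)"
  by (simp add: iterate_def noise_def)

text \<open>
  Columns of sum one make gossip invisible to the mean, which thus follows plain stochastic gradient descent along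
  the averaged local gradients.
\<close>

lemma mean_iterate_Suc:
  "mean_iterate (Suc t) \<omega> = mean_iterate t \<omega>
     - \<gamma> (Suc t) *\<^sub>R (avg n (local_grad t \<omega>) + avg n (noise t \<omega>))"
proof -
  have "(\<Sum>i<n. \<Sum>j<n. W $$ (i, j) *\<^sub>R iterate t \<omega> j) = (\<Sum>j<n. (\<Sum>i<n. W $$ (i, j)) *\<^sub>R iterate t \<omega> j)"
    by (subst sum.swap) (simp add: scaleR_sum_left)
  then have "avg n (\<lambda>i. \<Sum>j<n. W $$ (i, j) *\<^sub>R iterate t \<omega> j) = avg n (iterate t \<omega>)"
    using column_sums by (simp add: avg_def)
  then show ?thesis
    unfolding mean_iterate_def iterate_Suc[abs_def] avg_diff avg_scaleR avg_add by simp
qed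

lemma sample_measurable: "i < n \<Longrightarrow> t \<ge> 1 \<Longrightarrow> \<zeta> i t \<in> measurable M Z"
  using indep unfolding indep_vars_def by auto

lemma samples_measurable:
  assumes "J \<subseteq> {..<n} \<times> {1..}"
  shows "(\<lambda>\<omega>. \<lambda>k\<in>J. (case k of (i, t) \<Rightarrow> \<zeta> i t) \<omega>) \<in> measurable M (PiM J (\<lambda>_. Z))"
  using assms by (intro measurable_restrict) (auto intro!: sample_measurable)

lemma subalgebra_history:
  assumes "J \<subseteq> {..<n} \<times> {1..}"
  shows "subalgebra M (history J)"
  unfolding subalgebra_def history_def
  using samples_measurable[OF assms]
  by (auto simp: measurable_def sets_vimage_algebra2)

lemma history_sample_measurable:
  assumes J: "J \<subseteq> {..<n} \<times> {1..}" and k: "(i, t) \<in> J"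
  shows "\<zeta> i t \<in> measurable (history J) Z"
proof -
  have "(\<lambda>\<omega>. \<lambda>k\<in>J. (case k of (i, t) \<Rightarrow> \<zeta> i t) \<omega>) \<in> measurable (history J) (PiM J (\<lambda>_. Z))"
    unfolding history_def using samples_measurable[OF J]
    by (intro measurable_vimage_algebra1) (auto simp: measurable_def)
  from measurable_compose[OF this measurable_component_singleton[OF k]] show ?thesis
    using k by simp
qed

text \<open>
  Independence of the samples separates the coordinates in \<open>J\<close> from the coordinate \<open>(i, t)\<close>. The generating
  events of the history are exactly the preimages under the first group, so \<open>Y\<close> and the remaining sample
  are independent, and equality of the laws is checked on rectangles.
\<close>

lemma history_indep:
  assumes J: "J \<subseteq> {..<n} \<times> {1..}" and i: "i < n" "t \<ge> 1" "(i, t) \<notin> J"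
    and Y: "Y \<in> measurable (history J) S"
  shows "distr M S Y \<Otimes>\<^sub>M distr M Z (\<zeta> i t) = distr M (S \<Otimes>\<^sub>M Z) (\<lambda>\<omega>. (Y \<omega>, \<zeta> i t \<omega>))"
proof -
  let ?R = "\<lambda>A \<omega>. \<lambda>k\<in>A. (case k of (i, t) \<Rightarrow> \<zeta> i t) \<omega>"
  have "indep_var (PiM J (\<lambda>_. Z)) (?R J) (PiM {(i, t)} (\<lambda>_. Z)) (?R {(i, t)})"
    using i J by (intro indep_var_restrict[OF indep]) auto
  then have R: "random_variable (PiM J (\<lambda>_. Z)) (?R J)"
    and ind: "indep_set (sigma_sets (space M) {?R J -` A \<inter> space M | A. A \<in> sets (PiM J (\<lambda>_. Z))})
      (sigma_sets (space M) {?R {(i, t)} -` A \<inter> space M | A. A \<in> sets (PiM {(i, t)} (\<lambda>_. Z))})"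
    unfolding indep_var_eq by auto
  have X[measurable]: "\<zeta> i t \<in> measurable M Z" by (rule sample_measurable[OF i(1,2)])
  have sub: "subalgebra M (history J)" by (rule subalgebra_history[OF J])
  have Y'[measurable]: "Y \<in> measurable M S" by (rule measurable_from_subalg[OF sub Y])
  have sp: "space (history J) = space M" using sub unfolding subalgebra_def by simp
  have sets_eq: "sets (history J) = {?R J -` A \<inter> space M | A. A \<in> sets (PiM J (\<lambda>_. Z))}"
    unfolding history_def using R by (intro sets_vimage_algebra2) (auto simp: measurable_def)
  interpret DY: prob_space "distr M S Y" by (rule prob_space_distr[OF Y'])
  interpret DX: prob_space "distr M Z (\<zeta> i t)" by (rule prob_space_distr[OF X])
  show ?thesis
  proof (rule pair_measure_eqI)
    show "sets (distr M S Y \<Otimes>\<^sub>M distr M Z (\<zeta> i t)) = sets (distr M (S \<Otimes>\<^sub>M Z) (\<lambda>\<omega>. (Y \<omega>, \<zeta> i t \<omega>)))"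
      by (simp cong: sets_pair_measure_cong)
    fix A C assume "A \<in> sets (distr M S Y)" "C \<in> sets (distr M Z (\<zeta> i t))"
    then have A[measurable]: "A \<in> sets S" and C[measurable]: "C \<in> sets Z" by simp_all
    have "Y -` A \<inter> space M \<in> sets (history J)"
      using measurable_sets[OF Y A] sp by simp
    then have 1: "Y -` A \<inter> space M \<in> sigma_sets (space M) {?R J -` A \<inter> space M | A. A \<in> sets (PiM J (\<lambda>_. Z))}"
      unfolding sets_eq by (rule sigma_sets.Basic)
    let ?C = "(\<lambda>x. x (i, t)) -` C \<inter> space (PiM {(i, t)} (\<lambda>_. Z))"
    have "?C \<in> sets (PiM {(i, t)} (\<lambda>_. Z))"
      by (rule measurable_sets[OF measurable_component_singleton[of "(i, t)" "{(i, t)}" "\<lambda>_. Z", OF singletonI] C])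
    moreover have "\<zeta> i t -` C \<inter> space M = ?R {(i, t)} -` ?C \<inter> space M"
      using measurable_space[OF X] by (auto simp: space_PiM)
    ultimately have 2: "\<zeta> i t -` C \<inter> space M
        \<in> sigma_sets (space M) {?R {(i, t)} -` A \<inter> space M | A. A \<in> sets (PiM {(i, t)} (\<lambda>_. Z))}"
      by (intro sigma_sets.Basic) blast
    have "prob ((Y -` A \<inter> space M) \<inter> (\<zeta> i t -` C \<inter> space M))
        = prob (Y -` A \<inter> space M) * prob (\<zeta> i t -` C \<inter> space M)"
      by (rule indep_setD[OF ind 1 2])
    moreover have "(Y -` A \<inter> space M) \<inter> (\<zeta> i t -` C \<inter> space M) = (\<lambda>\<omega>. (Y \<omega>, \<zeta> i t \<omega>)) -` (A \<times> C) \<inter> space M"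
      by auto
    ultimately show "emeasure (distr M S Y) A * emeasure (distr M Z (\<zeta> i t)) C
        = emeasure (distr M (S \<Otimes>\<^sub>M Z) (\<lambda>\<omega>. (Y \<omega>, \<zeta> i t \<omega>))) (A \<times> C)"
      by (simp add: emeasure_distr emeasure_eq_measure ennreal_mult[symmetric])
  qed (rule DY.sigma_finite_measure_axioms DX.sigma_finite_measure_axioms)+
qed

text \<open>Indices of the samples that have been used to compute the iterates at time \<open>t\<close>.\<close>

definition past :: "nat \<Rightarrow> (nat \<times> nat) set" where
  "past t = {..<n} \<times> {1..t}"

lemma past_subset: "past t \<subseteq> {..<n} \<times> {1..}"
  by (auto simp: past_def)

lemma F_measurable: "i < n \<Longrightarrow> F i \<in> borel_measurable borel"
proof (rule borel_measurable_continuous_onI)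
  assume "i < n"
  have "L-lipschitz_on UNIV (F i)"
    using F_lipschitz[OF \<open>i < n\<close>] L by (intro lipschitz_onI) (auto simp: dist_norm norm_minus_commute)
  then show "continuous_on UNIV (F i)" by (rule lipschitz_on_continuous_on)
qed

lemma iterate_history_measurable:
  assumes J: "J \<subseteq> {..<n} \<times> {1..}"
  shows "past t \<subseteq> J \<Longrightarrow> i < n \<Longrightarrow> (\<lambda>\<omega>. iterate t \<omega> i) \<in> borel_measurable (history J)"
proof (induction t arbitrary: i)
  case 0
  then show ?case by (simp add: iterate_def)
next
  case (Suc t)
  have "past t \<subseteq> J" using Suc.prems by (auto simp: past_def)
  then have IH: "(\<lambda>\<omega>. iterate t \<omega> j) \<in> borel_measurable (history J)" if "j < n" for j
    using Suc.IH that by blast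
  have "(i, Suc t) \<in> J" using Suc.prems by (auto simp: past_def)
  then have "(\<lambda>\<omega>. (iterate t \<omega> i, \<zeta> i (Suc t) \<omega>)) \<in> measurable (history J) (borel \<Otimes>\<^sub>M Z)"
    by (intro measurable_Pair IH Suc.prems history_sample_measurable J)
  from measurable_compose[OF this grad_meas]
  have "(\<lambda>\<omega>. grad_loss l (iterate t \<omega> i) (\<zeta> i (Suc t) \<omega>)) \<in> borel_measurable (history J)" by simp
  moreover have "iterate (Suc t) \<omega> i = (\<Sum>j<n. W $$ (i, j) *\<^sub>R iterate t \<omega> j)
     - \<gamma> (Suc t) *\<^sub>R grad_loss l (iterate t \<omega> i) (\<zeta> i (Suc t) \<omega>)" for \<omega>
    by (simp add: iterate_def)
  ultimately show ?case
    using IH by (auto intro!: borel_measurable_diff borel_measurable_sum)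
qed

lemma local_grad_history_measurable:
  assumes "J \<subseteq> {..<n} \<times> {1..}" "past t \<subseteq> J" "i < n"
  shows "(\<lambda>\<omega>. local_grad t \<omega> i) \<in> borel_measurable (history J)"
  unfolding local_grad_def
  by (rule measurable_compose[OF iterate_history_measurable[OF assms] F_measurable[OF assms(3)]])

lemma noise_history_measurable:
  assumes "J \<subseteq> {..<n} \<times> {1..}" "past t \<subseteq> J" "i < n" "(i, Suc t) \<in> J"
  shows "(\<lambda>\<omega>. noise t \<omega> i) \<in> borel_measurable (history J)"
proof -
  have "(\<lambda>\<omega>. (iterate t \<omega> i, \<zeta> i (Suc t) \<omega>)) \<in> measurable (history J) (borel \<Otimes>\<^sub>M Z)"
    by (intro measurable_Pair iterate_history_measurable history_sample_measurable assms)
  from measurable_compose[OF this grad_meas]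
  have "(\<lambda>\<omega>. grad_loss l (iterate t \<omega> i) (\<zeta> i (Suc t) \<omega>)) \<in> borel_measurable (history J)" by simp
  with local_grad_history_measurable[OF assms(1-3)] show ?thesis
    unfolding noise_def by measurable
qed

lemma noise_measurable: "i < n \<Longrightarrow> (\<lambda>\<omega>. noise t \<omega> i) \<in> borel_measurable M"
  by (rule measurable_from_subalg[OF subalgebra_history[OF past_subset[of "Suc t"]]
        noise_history_measurable[OF past_subset]])
     (auto simp: past_def)

text \<open>
  The iterate is a function of past samples, hence independent of the fresh one; integrating out the fresh sample
  at a fixed value of the iterate leaves the moment of the stochastic gradient at a fixed point.
\<close>

lemma noise_moment:
  assumes i: "i < n"
    and int: "\<And>x. integrable (B i) (\<lambda>z. norm (grad_loss l x z - F i x) ^ p)"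
    and le: "\<And>x. (\<integral>z. norm (grad_loss l x z - F i x) ^ p \<partial>B i) \<le> c"
  shows "integrable M (\<lambda>\<omega>. norm (noise t \<omega> i) ^ p)"
    and "expectation (\<lambda>\<omega>. norm (noise t \<omega> i) ^ p) \<le> c"
proof -
  define h where "h = (\<lambda>(x, z). ennreal (norm (grad_loss l x z - F i x) ^ p))"
  note [measurable] = F_measurable[OF i] noise_measurable[OF i]
  have h: "h \<in> borel_measurable (borel \<Otimes>\<^sub>M Z)"
    using grad_meas unfolding h_def split_beta' by measurable
  have "(\<integral>\<^sup>+\<omega>. h (iterate t \<omega> i, \<zeta> i (Suc t) \<omega>) \<partial>M) \<le> ennreal c"
  proof (rule product_distr_nn_integral_le[OF _ _ history_indep[OF past_subset[of t] i] h])
    show "(\<lambda>\<omega>. iterate t \<omega> i) \<in> borel_measurable (history (past t))"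
      by (rule iterate_history_measurable[OF past_subset order_refl i])
    then show "(\<lambda>\<omega>. iterate t \<omega> i) \<in> borel_measurable M"
      by (rule measurable_from_subalg[OF subalgebra_history[OF past_subset]])
    show "\<zeta> i (Suc t) \<in> measurable M Z" by (rule sample_measurable[OF i]) simp
    show "(i, Suc t) \<notin> past t" by (simp add: past_def)
    fix x
    have "(\<integral>\<^sup>+z. h (x, z) \<partial>B i) = ennreal (\<integral>z. norm (grad_loss l x z - F i x) ^ p \<partial>B i)"
      unfolding h_def by (simp add: nn_integral_eq_integral int)
    then show "(\<integral>\<^sup>+z. h (x, z) \<partial>distr M Z (\<zeta> i (Suc t))) \<le> ennreal c"
      using le[of x] by (simp add: distr i ennreal_leI)
  qed simp
  then have *: "(\<integral>\<^sup>+\<omega>. ennreal (norm (noise t \<omega> i) ^ p) \<partial>M) \<le> ennreal c"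
    by (simp add: h_def noise_def local_grad_def)
  show int_noise: "integrable M (\<lambda>\<omega>. norm (noise t \<omega> i) ^ p)"
    by (rule integrableI_bounded) (use * in \<open>auto simp: le_less_trans\<close>)
  have "c \<ge> 0"
    using le[of 0] by (rule order_trans[rotated]) (intro Bochner_Integration.integral_nonneg; simp)
  with * show "expectation (\<lambda>\<omega>. norm (noise t \<omega> i) ^ p) \<le> c"
    by (subst (asm) nn_integral_eq_integral[OF int_noise]) auto
qed

lemmas noise_moment2 = noise_moment[OF _ moment2]
lemmas noise_moment4 = noise_moment[OF _ moment4]

text \<open>
  The martingale property in integrated form. The set \<open>J\<close> may also contain other agents' samples of the
  same round, which yields both orthogonality to the past and pairwise orthogonality of the agents' noises.
\<close>

lemma noise_orthogonal:
  assumes i: "i < n" and J: "J \<subseteq> {..<n} \<times> {1..}" "past t \<subseteq> J" "(i, Suc t) \<notin> J"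
    and Y: "Y \<in> borel_measurable (history J)"
    and int: "integrable M (\<lambda>\<omega>. norm (Y \<omega>) * norm (noise t \<omega> i))"
  shows "integrable M (\<lambda>\<omega>. inner (noise t \<omega> i) (Y \<omega>))"
    and "expectation (\<lambda>\<omega>. inner (noise t \<omega> i) (Y \<omega>)) = 0"
proof -
  note [measurable] = F_measurable[OF i] noise_measurable[OF i]
  have [measurable]: "Y \<in> borel_measurable M"
    by (rule measurable_from_subalg[OF subalgebra_history[OF J(1)] Y])
  show integ: "integrable M (\<lambda>\<omega>. inner (noise t \<omega> i) (Y \<omega>))"
  proof (rule Bochner_Integration.integrable_bound[OF int])
    show "AE \<omega> in M. norm (inner (noise t \<omega> i) (Y \<omega>)) \<le> norm (norm (Y \<omega>) * norm (noise t \<omega> i))"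
      using Cauchy_Schwarz_ineq2 by (intro AE_I2) (simp add: mult.commute[of "norm (Y _)"])
  qed measurable
  define h where "h = (\<lambda>((x, y), z). inner (grad_loss l x z - F i x) y)"
  have pr: "(\<lambda>p. (fst (fst p), snd p)) \<in> measurable (((borel :: 'a measure) \<Otimes>\<^sub>M (borel :: 'a measure)) \<Otimes>\<^sub>M Z) (borel \<Otimes>\<^sub>M Z)"
    by measurable
  have [measurable]: "(\<lambda>p. grad_loss l (fst (fst p)) (snd p))
      \<in> borel_measurable (((borel :: 'a measure) \<Otimes>\<^sub>M (borel :: 'a measure)) \<Otimes>\<^sub>M Z)"
    using measurable_compose[OF pr grad_meas] by simp
  have h: "h \<in> borel_measurable ((borel \<Otimes>\<^sub>M borel) \<Otimes>\<^sub>M Z)"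
    unfolding h_def split_beta' by measurable
  have Y': "(\<lambda>\<omega>. (iterate t \<omega> i, Y \<omega>)) \<in> measurable (history J) (borel \<Otimes>\<^sub>M borel)"
    using Y by (intro J measurable_Pair iterate_history_measurable i) auto
  have "expectation (\<lambda>\<omega>. h ((iterate t \<omega> i, Y \<omega>), \<zeta> i (Suc t) \<omega>)) = 0"
  proof (rule product_distr_expectation_zero[OF _ _ history_indep[OF J(1) i _ J(3) Y'] h])
    show "(\<lambda>\<omega>. (iterate t \<omega> i, Y \<omega>)) \<in> measurable M (borel \<Otimes>\<^sub>M borel)"
      by (rule measurable_from_subalg[OF subalgebra_history[OF J(1)] Y'])
    show "\<zeta> i (Suc t) \<in> measurable M Z" by (rule sample_measurable[OF i]) simp
    show "integrable M (\<lambda>\<omega>. h ((iterate t \<omega> i, Y \<omega>), \<zeta> i (Suc t) \<omega>))"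
      using integ by (simp add: h_def noise_def local_grad_def)
    fix q :: "'a \<times> 'a"
    obtain x y where q: "q = (x, y)" by force
    interpret Bi: prob_space "B i"
      using prob_space_distr[OF sample_measurable[OF i, of "Suc t"]] distr[OF i, of "Suc t"] by simp
    have "has_bochner_integral (B i) (\<lambda>z. inner (grad_loss l x z - F i x) y) (inner (F i x - F i x) y)"
      by (intro has_bochner_integral_inner_left has_bochner_integral_diff unbiased i)
         (use has_bochner_integral_integrable[of "B i" "\<lambda>_. F i x"] Bi.prob_space in simp)
    then show "(\<integral>z. h (q, z) \<partial>distr M Z (\<zeta> i (Suc t))) = 0"
      by (simp add: distr i h_def q has_bochner_integral_integral_eq)
  qed simp
  then show "expectation (\<lambda>\<omega>. inner (noise t \<omega> i) (Y \<omega>)) = 0"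
    by (simp add: h_def noise_def local_grad_def)
qed

lemma noise_fourth_moment: "i < n \<Longrightarrow> has_fourth_moment (\<lambda>\<omega>. noise t \<omega> i)"
  unfolding has_fourth_moment_def by (intro conjI noise_measurable noise_moment4)

lemma iterate_fourth_moment: "i < n \<Longrightarrow> has_fourth_moment (\<lambda>\<omega>. iterate t \<omega> i)"
proof (induction t arbitrary: i)
  case 0
  then show ?case by (simp add: iterate_def has_fourth_moment_const)
next
  case (Suc t)
  then show ?case
    unfolding iterate_Suc local_grad_def
    by (intro has_fourth_moment_diff has_fourth_moment_sum has_fourth_moment_scaleR
        has_fourth_moment_add noise_fourth_moment has_fourth_moment_lipschitz[OF _ F_lipschitz L]
        F_measurable) auto
qed

lemma local_grad_fourth_moment: "i < n \<Longrightarrow> has_fourth_moment (\<lambda>\<omega>. local_grad t \<omega> i)"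
  unfolding local_grad_def
  by (intro has_fourth_moment_lipschitz[OF iterate_fourth_moment F_lipschitz L] F_measurable)

lemma mean_iterate_fourth_moment: "has_fourth_moment (mean_iterate t)"
  unfolding mean_iterate_def[abs_def] by (intro has_fourth_moment_avg iterate_fourth_moment)

text \<open>Noises of different agents are orthogonal, so only the \<open>n\<close> diagonal terms of the squared mean survive.\<close>

lemma expectation_norm_avg_noise_le:
  "expectation (\<lambda>\<omega>. (norm (avg n (noise t \<omega>)))\<^sup>2) \<le> \<sigma>\<^sup>2 / real n"
proof -
  have cross: "expectation (\<lambda>\<omega>. inner (noise t \<omega> i) (noise t \<omega> j)) = 0"
    if ij: "i < n" "j < n" "i \<noteq> j" for i j
  proof (rule noise_orthogonal(2)[where J = "insert (j, Suc t) (past t)"])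
    show "(\<lambda>\<omega>. noise t \<omega> j) \<in> borel_measurable (history (insert (j, Suc t) (past t)))"
      using ij by (intro noise_history_measurable) (auto simp: past_def)
    show "integrable M (\<lambda>\<omega>. norm (noise t \<omega> j) * norm (noise t \<omega> i))"
      by (intro has_fourth_moment_integrable_norm_mult noise_fourth_moment ij)
  qed (use ij in \<open>auto simp: past_def\<close>)
  have eq: "(norm (avg n (noise t \<omega>)))\<^sup>2 = (\<Sum>i<n. \<Sum>j<n. inner (noise t \<omega> i) (noise t \<omega> j)) / (real n)\<^sup>2" for \<omega>
  proof -
    have "inner (\<Sum>i<n. noise t \<omega> i) (\<Sum>j<n. noise t \<omega> j) = (\<Sum>i<n. \<Sum>j<n. inner (noise t \<omega> i) (noise t \<omega> j))"
      unfolding inner_sum_left unfolding inner_sum_right ..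
    then show ?thesis
      by (simp add: avg_def power_divide) (simp add: power2_norm_eq_inner)
  qed
  have "expectation (\<lambda>\<omega>. (norm (avg n (noise t \<omega>)))\<^sup>2)
      = (\<Sum>i<n. \<Sum>j<n. expectation (\<lambda>\<omega>. inner (noise t \<omega> i) (noise t \<omega> j))) / (real n)\<^sup>2"
  proof -
    have int: "integrable M (\<lambda>\<omega>. inner (noise t \<omega> i) (noise t \<omega> j))" if "i < n" "j < n" for i j
      by (intro has_fourth_moment_integrable_inner noise_fourth_moment that)
    have "expectation (\<lambda>\<omega>. \<Sum>i<n. \<Sum>j<n. inner (noise t \<omega> i) (noise t \<omega> j))
        = (\<Sum>i<n. expectation (\<lambda>\<omega>. \<Sum>j<n. inner (noise t \<omega> i) (noise t \<omega> j)))"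
      using int by (intro Bochner_Integration.integral_sum Bochner_Integration.integrable_sum) auto
    also have "\<dots> = (\<Sum>i<n. \<Sum>j<n. expectation (\<lambda>\<omega>. inner (noise t \<omega> i) (noise t \<omega> j)))"
      using int by (intro sum.cong refl Bochner_Integration.integral_sum) auto
    finally show ?thesis unfolding eq by simp
  qed
  also have "\<dots> = (\<Sum>i<n. \<Sum>j<n. if i = j then expectation (\<lambda>\<omega>. (norm (noise t \<omega> i))\<^sup>2) else 0) / (real n)\<^sup>2"
    using cross by (intro arg_cong2[where f = "(/)"] sum.cong) (auto simp: power2_norm_eq_inner)
  also have "\<dots> = (\<Sum>i<n. expectation (\<lambda>\<omega>. (norm (noise t \<omega> i))\<^sup>2)) / (real n)\<^sup>2"
    by simp
  also have "\<dots> \<le> (\<Sum>i<n. \<sigma>\<^sup>2) / (real n)\<^sup>2"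
    by (intro divide_right_mono sum_mono noise_moment2) auto
  also have "\<dots> = \<sigma>\<^sup>2 / real n" using n by (simp add: power2_eq_square)
  finally show ?thesis .
qed

end

section \<open>Moments of the consensus error\<close>

text \<open>
  Expands \<open>|P + N|\<^sup>4\<close> with \<open>q = |P|\<^sup>2\<close>, \<open>c = P \<bullet> N\<close>, \<open>m = |N|\<^sup>2\<close>. Only the term \<open>4 q c\<close> is kept as it is, because its
  expectation vanishes for centred noise \<open>N\<close>; the mixed term \<open>8 q m\<close> is split by Young's inequality
  into terms whose expectations are bounded separately.
\<close>

lemma power2_expansion_le:
  fixes q c m e :: real
  assumes q: "q \<ge> 0" and m: "m \<ge> 0" and c: "c\<^sup>2 \<le> q * m" and e: "e > 0"
  shows "(q + 2 * c + m)\<^sup>2 \<le> (1 + e) * q\<^sup>2 + 4 * q * c + (3 + 16 / e) * m\<^sup>2"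
proof -
  have "0 \<le> (e * q - 4 * m)\<^sup>2 / e" using e by simp
  also have "\<dots> = e * q\<^sup>2 - 8 * (q * m) + 16 / e * m\<^sup>2"
    using e by (simp add: field_simps power2_eq_square)
  finally have "8 * (q * m) \<le> e * q\<^sup>2 + 16 / e * m\<^sup>2" by simp
  moreover have "4 * (c * m) \<le> 2 * c\<^sup>2 + 2 * m\<^sup>2"
    using zero_le_power2[of "c - m"] by (simp add: power2_eq_square algebra_simps)
  moreover have "(q + 2 * c + m)\<^sup>2 = q\<^sup>2 + 4 * q * c + 2 * (q * m) + 4 * c\<^sup>2 + 4 * (c * m) + m\<^sup>2"
    by (simp add: power2_eq_square algebra_simps)
  moreover have "(1 + e) * q\<^sup>2 + 4 * q * c + (3 + 16 / e) * m\<^sup>2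
      = q\<^sup>2 + 4 * q * c + 3 * m\<^sup>2 + (e * q\<^sup>2 + 16 / e * m\<^sup>2)"
    by (simp add: algebra_simps)
  ultimately show ?thesis using c by linarith
qed

text \<open>
  The step sizes enter in the two ways in which they are used: \<open>\<gamma> t * L \<le> \<rho> / 9\<close> makes the gradient step spoil
  only a ninth of the spectral gap, and \<open>step_ratio\<close> limits how fast the steps may decrease.
\<close>

locale dsgd_consensus = dsgd_process M n Z B l F W \<zeta> \<gamma> \<theta>0 L \<sigma>
  for M :: "'w measure" and n :: nat and Z :: "'z measure" and B :: "nat \<Rightarrow> 'z measure"
    and l :: "'a::euclidean_space \<Rightarrow> 'z \<Rightarrow> real" and F :: "nat \<Rightarrow> 'a \<Rightarrow> 'a"
    and W :: "real Matrix.mat" and \<zeta> :: "nat \<Rightarrow> nat \<Rightarrow> 'w \<Rightarrow> 'z"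
    and \<gamma> :: "nat \<Rightarrow> real" and \<theta>0 :: "nat \<Rightarrow> 'a" and L \<sigma> :: real +
  fixes \<rho> \<tau> :: real
  assumes rho: "0 < \<rho>" "\<rho> \<le> 1"
    and contraction: "\<And>x :: nat \<Rightarrow> 'a. (\<Sum>i<n. x i) = 0 \<Longrightarrow>
      stack_norm n (\<lambda>i. \<Sum>j<n. W $$ (i, j) *\<^sub>R x j) \<le> (1 - \<rho>) * stack_norm n x"
    and step_pos: "\<And>t. t \<ge> 1 \<Longrightarrow> \<gamma> t > 0"
    and step_L: "\<And>t. t \<ge> 1 \<Longrightarrow> \<gamma> t * L \<le> \<rho> / 9"
    and step_ratio: "\<And>t. t \<ge> 1 \<Longrightarrow> \<gamma> t ^ 4 * (1 - \<rho> / 2) \<le> (1 - \<rho> / 4) * \<gamma> (Suc t) ^ 4"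
    and tau: "\<tau> \<ge> 0"
    and heterogeneity: "\<And>i x. i < n \<Longrightarrow> norm (avg n (\<lambda>j. F j x) - F i x) \<le> \<tau>"
    and init: "\<And>i. i < n \<Longrightarrow> \<theta>0 i = avg n \<theta>0"
begin

definition deviation :: "nat \<Rightarrow> 'w \<Rightarrow> nat \<Rightarrow> 'a" where
  "deviation t \<omega> i = iterate t \<omega> i - mean_iterate t \<omega>"

definition consensus :: "nat \<Rightarrow> 'w \<Rightarrow> real" where
  "consensus t \<omega> = stack_norm n (deviation t \<omega>)"

text \<open>The noise-free part of the next deviation.\<close>

definition drift :: "nat \<Rightarrow> 'w \<Rightarrow> nat \<Rightarrow> 'a" where
  "drift t \<omega> i = (\<Sum>j<n. W $$ (i, j) *\<^sub>R deviation t \<omega> j)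
     - \<gamma> (Suc t) *\<^sub>R (local_grad t \<omega> i - avg n (local_grad t \<omega>))"

definition cross :: "nat \<Rightarrow> 'w \<Rightarrow> real" where
  "cross t \<omega> = (\<Sum>i<n. inner (noise t \<omega> i) (drift t \<omega> i))"

lemma sum_deviation: "(\<Sum>i<n. deviation t \<omega> i) = 0"
  unfolding deviation_def mean_iterate_def by (rule sum_diff_avg[OF n])

lemma consensus_nonneg: "consensus t \<omega> \<ge> 0"
  by (simp add: consensus_def stack_norm_nonneg)

lemma sum_mix_deviation: "(\<Sum>i<n. \<Sum>j<n. W $$ (i, j) *\<^sub>R deviation t \<omega> j) = 0"
proof -
  have "(\<Sum>i<n. \<Sum>j<n. W $$ (i, j) *\<^sub>R deviation t \<omega> j) = (\<Sum>j<n. (\<Sum>i<n. W $$ (i, j)) *\<^sub>R deviation t \<omega> j)"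
    by (subst sum.swap) (simp add: scaleR_sum_left)
  also have "\<dots> = 0" using column_sums sum_deviation by simp
  finally show ?thesis .
qed

lemma sum_drift: "(\<Sum>i<n. drift t \<omega> i) = 0"
  unfolding drift_def sum_subtractf sum_mix_deviation scaleR_sum_right[symmetric]
  using sum_diff_avg[OF n, of "local_grad t \<omega>"] by (simp add: sum_subtractf)

lemma deviation_Suc:
  assumes i: "i < n"
  shows "deviation (Suc t) \<omega> i
    = drift t \<omega> i + (- \<gamma> (Suc t)) *\<^sub>R (noise t \<omega> i - avg n (noise t \<omega>))"
proof -
  have "(\<Sum>j<n. W $$ (i, j) *\<^sub>R deviation t \<omega> j) = (\<Sum>j<n. W $$ (i, j) *\<^sub>R iterate t \<omega> j) - mean_iterate t \<omega>"
    using row_sums[OF i] by (simp add: deviation_def scaleR_diff_right sum_subtractf scaleR_sum_left[symmetric])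
  then show ?thesis
    unfolding deviation_def[of "Suc t"] drift_def iterate_Suc mean_iterate_Suc
    by (simp add: algebra_simps)
qed

text \<open>
  Gossip contracts deviations by \<open>1 - \<rho>\<close>. Subtracting the mean minimises the total squared distance, so the
  centred local gradients may be compared with the global gradient at the mean iterate: this costs \<open>L\<close> times the
  deviation, absorbed in \<open>\<rho> / 9\<close>, plus the heterogeneity \<open>\<tau>\<close> of each of the \<open>n\<close> agents.
\<close>

lemma drift_le:
  "stack_norm n (drift t \<omega>) \<le> (1 - 8 * \<rho> / 9) * consensus t \<omega> + \<gamma> (Suc t) * \<tau> * sqrt (real n)"
proof -
  let ?g = "\<gamma> (Suc t)" and ?m = "mean_iterate t \<omega>"
  have g: "?g > 0" by (rule step_pos) simp
  define G where "G i = local_grad t \<omega> i - avg n (local_grad t \<omega>)" for i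
  have "stack_norm n G \<le> stack_norm n (\<lambda>i. local_grad t \<omega> i - avg n (\<lambda>j. F j ?m))"
    unfolding G_def by (rule power2_le_imp_le) (simp_all add: stack_norm_power2 sum_norm_diff_avg_le[OF n] stack_norm_nonneg)
  also have "\<dots> \<le> L2_set (\<lambda>i. L * norm (deviation t \<omega> i) + \<tau>) {..<n}"
    unfolding stack_norm_def
  proof (rule L2_set_mono)
    fix i assume "i \<in> {..<n}" then have i: "i < n" by simp
    have "norm (local_grad t \<omega> i - avg n (\<lambda>j. F j ?m))
        \<le> norm (local_grad t \<omega> i - F i ?m) + norm (avg n (\<lambda>j. F j ?m) - F i ?m)"
      using norm_triangle_ineq4[of "local_grad t \<omega> i - F i ?m" "avg n (\<lambda>j. F j ?m) - F i ?m"] by simp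
    also have "\<dots> \<le> L * norm (deviation t \<omega> i) + \<tau>"
      unfolding local_grad_def deviation_def by (intro add_mono F_lipschitz heterogeneity i)
    finally show "norm (local_grad t \<omega> i - avg n (\<lambda>j. F j ?m)) \<le> L * norm (deviation t \<omega> i) + \<tau>" .
  qed simp
  also have "\<dots> \<le> L2_set (\<lambda>i. L * norm (deviation t \<omega> i)) {..<n} + L2_set (\<lambda>_. \<tau>) {..<n}"
    by (rule L2_set_triangle_ineq)
  also have "\<dots> = L * consensus t \<omega> + \<tau> * sqrt (real n)"
    using L tau by (simp add: consensus_def stack_norm_def L2_set_right_distrib L2_set_constant)
  finally have G: "stack_norm n G \<le> L * consensus t \<omega> + \<tau> * sqrt (real n)" .
  have "stack_norm n (drift t \<omega>) \<le> stack_norm n (\<lambda>i. \<Sum>j<n. W $$ (i, j) *\<^sub>R deviation t \<omega> j)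
      + stack_norm n (\<lambda>i. (- ?g) *\<^sub>R G i)"
    using stack_norm_triangle[of n "\<lambda>i. \<Sum>j<n. W $$ (i, j) *\<^sub>R deviation t \<omega> j" "\<lambda>i. (- ?g) *\<^sub>R G i"]
    by (simp add: drift_def[abs_def] G_def)
  also have "\<dots> \<le> (1 - \<rho>) * consensus t \<omega> + ?g * (L * consensus t \<omega> + \<tau> * sqrt (real n))"
    unfolding stack_norm_scaleR consensus_def
    using g G[unfolded consensus_def] by (intro add_mono contraction sum_deviation) simp
  also have "\<dots> = (1 - \<rho> + ?g * L) * consensus t \<omega> + ?g * \<tau> * sqrt (real n)"
    by (simp add: algebra_simps)
  also have "\<dots> \<le> (1 - 8 * \<rho> / 9) * consensus t \<omega> + ?g * \<tau> * sqrt (real n)"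
    using step_L[of "Suc t"] consensus_nonneg by (intro add_right_mono mult_right_mono) auto
  finally show ?thesis .
qed

text \<open>
  The drift has zero sum, so in the cross term the centring of the noise can be dropped.
\<close>

lemma
  shows consensus_power2_Suc_le: "(consensus (Suc t) \<omega>)\<^sup>2 \<le> (stack_norm n (drift t \<omega>))\<^sup>2
      - 2 * \<gamma> (Suc t) * cross t \<omega> + \<gamma> (Suc t) ^ 2 * (stack_norm n (noise t \<omega>))\<^sup>2" (is ?second)
    and consensus_power4_Suc_le: "consensus (Suc t) \<omega> ^ 4 \<le> (1 + \<rho> / 4) * stack_norm n (drift t \<omega>) ^ 4
      - 4 * \<gamma> (Suc t) * ((stack_norm n (drift t \<omega>))\<^sup>2 * cross t \<omega>)
      + (3 + 64 / \<rho>) * \<gamma> (Suc t) ^ 4 * stack_norm n (noise t \<omega>) ^ 4" (is ?fourth)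
proof -
  let ?g = "\<gamma> (Suc t)"
  define N where "N i = (- ?g) *\<^sub>R (noise t \<omega> i - avg n (noise t \<omega>))" for i
  define q where "q = (stack_norm n (drift t \<omega>))\<^sup>2"
  define c where "c = (\<Sum>i<n. inner (drift t \<omega> i) (N i))"
  define m where "m = (stack_norm n N)\<^sup>2"
  have q0: "q \<ge> 0" and m0: "m \<ge> 0" unfolding q_def m_def by simp_all
  have cross: "c = - ?g * cross t \<omega>"
  proof -
    have "c = (\<Sum>i<n. - ?g * inner (noise t \<omega> i) (drift t \<omega> i) + ?g * inner (drift t \<omega> i) (avg n (noise t \<omega>)))"
      unfolding c_def N_def by (intro sum.cong) (auto simp: inner_diff_right inner_commute algebra_simps)
    also have "\<dots> = - ?g * cross t \<omega> + ?g * inner (\<Sum>i<n. drift t \<omega> i) (avg n (noise t \<omega>))"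
      by (simp add: sum.distrib sum_subtractf sum_negf cross_def sum_distrib_left inner_sum_left)
    finally show ?thesis unfolding sum_drift by simp
  qed
  have expand: "(consensus (Suc t) \<omega>)\<^sup>2 = q + 2 * c + m"
  proof -
    have "(consensus (Suc t) \<omega>)\<^sup>2 = (\<Sum>i<n. (norm (drift t \<omega> i + N i))\<^sup>2)"
      unfolding consensus_def stack_norm_power2 by (intro sum.cong) (auto simp: deviation_Suc N_def)
    also have "\<dots> = (\<Sum>i<n. (norm (drift t \<omega> i))\<^sup>2 + 2 * inner (drift t \<omega> i) (N i) + (norm (N i))\<^sup>2)"
      by (intro sum.cong) (auto simp: power2_norm_eq_inner inner_add_left inner_add_right inner_commute)
    finally show ?thesis
      unfolding q_def c_def m_def stack_norm_power2 by (simp add: sum.distrib sum_distrib_left)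
  qed
  have m: "m \<le> ?g ^ 2 * (stack_norm n (noise t \<omega>))\<^sup>2"
  proof -
    have "m = ?g ^ 2 * (\<Sum>i<n. (norm (noise t \<omega> i - avg n (noise t \<omega>)))\<^sup>2)"
      unfolding m_def stack_norm_power2 N_def by (simp add: power_mult_distrib sum_distrib_left)
    also have "\<dots> \<le> ?g ^ 2 * (\<Sum>i<n. (norm (noise t \<omega> i - 0))\<^sup>2)"
      by (intro mult_left_mono sum_norm_diff_avg_le[OF n]) simp
    finally show ?thesis by (simp add: stack_norm_power2)
  qed
  show ?second using expand m cross unfolding q_def by simp
  have "\<bar>c\<bar>\<^sup>2 \<le> (stack_norm n (drift t \<omega>) * stack_norm n N)\<^sup>2"
    unfolding c_def by (intro power_mono sum_inner_le_stack_norm) simp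
  then have "c\<^sup>2 \<le> q * m" unfolding q_def m_def by (simp add: power_mult_distrib)
  then have "(q + 2 * c + m)\<^sup>2 \<le> (1 + \<rho> / 4) * q\<^sup>2 + 4 * q * c + (3 + 64 / \<rho>) * m\<^sup>2"
    using power2_expansion_le[OF q0 m0, of c "\<rho> / 4"] rho by simp
  also have "\<dots> \<le> (1 + \<rho> / 4) * q\<^sup>2 + 4 * q * c + (3 + 64 / \<rho>) * (?g ^ 2 * (stack_norm n (noise t \<omega>))\<^sup>2)\<^sup>2"
    by (rule add_left_mono[OF mult_left_mono[OF power_mono[OF m m0]]]) (use rho in simp)
  finally have "((consensus (Suc t) \<omega>)\<^sup>2)\<^sup>2 \<le> \<dots>" unfolding expand .
  then show ?fourth
    unfolding cross q_def by (simp add: power_mult_distrib algebra_simps)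
qed

lemma deviation_fourth_moment: "i < n \<Longrightarrow> has_fourth_moment (\<lambda>\<omega>. deviation t \<omega> i)"
  unfolding deviation_def
  by (intro has_fourth_moment_diff iterate_fourth_moment mean_iterate_fourth_moment)

lemma consensus_fourth_moment: "has_fourth_moment (consensus t)"
  unfolding consensus_def[abs_def] by (intro has_fourth_moment_stack_norm deviation_fourth_moment)

lemma integrable_consensus_power2: "integrable M (\<lambda>\<omega>. (consensus t \<omega>)\<^sup>2)"
  using has_fourth_moment_integrable_norm_power2[OF consensus_fourth_moment] by simp

lemma integrable_consensus_power4: "integrable M (\<lambda>\<omega>. consensus t \<omega> ^ 4)"
  using has_fourth_moment_integrable[OF consensus_fourth_moment] by simp

lemma drift_fourth_moment: "i < n \<Longrightarrow> has_fourth_moment (\<lambda>\<omega>. drift t \<omega> i)"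
  unfolding drift_def
  by (intro has_fourth_moment_diff has_fourth_moment_sum has_fourth_moment_scaleR has_fourth_moment_avg
      deviation_fourth_moment local_grad_fourth_moment) auto

lemma stack_drift_fourth_moment: "has_fourth_moment (\<lambda>\<omega>. stack_norm n (drift t \<omega>))"
  by (intro has_fourth_moment_stack_norm drift_fourth_moment)

lemma stack_noise_fourth_moment: "has_fourth_moment (\<lambda>\<omega>. stack_norm n (noise t \<omega>))"
  by (intro has_fourth_moment_stack_norm noise_fourth_moment)

lemma avg_history_measurable:
  "(\<And>i. i < n \<Longrightarrow> (\<lambda>\<omega>. X \<omega> i) \<in> borel_measurable N) \<Longrightarrow> (\<lambda>\<omega>. avg n (X \<omega>) :: 'a) \<in> borel_measurable N"
  unfolding avg_def by (intro borel_measurable_scaleR borel_measurable_sum) auto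

lemma mean_iterate_history_measurable: "mean_iterate t \<in> borel_measurable (history (past t))"
  unfolding mean_iterate_def[abs_def]
  by (intro avg_history_measurable iterate_history_measurable past_subset order_refl)

lemma drift_history_measurable:
  assumes i: "i < n"
  shows "(\<lambda>\<omega>. drift t \<omega> i) \<in> borel_measurable (history (past t))"
  unfolding drift_def deviation_def using i
  by (intro borel_measurable_diff borel_measurable_sum borel_measurable_scaleR borel_measurable_const
      avg_history_measurable iterate_history_measurable local_grad_history_measurable
      mean_iterate_history_measurable past_subset order_refl) auto

lemma
  shows integrable_cross: "integrable M (cross t)"
    and expectation_cross: "expectation (cross t) = 0"
    and integrable_power2_cross: "integrable M (\<lambda>\<omega>. (stack_norm n (drift t \<omega>))\<^sup>2 * cross t \<omega>)"
    and expectation_power2_cross: "expectation (\<lambda>\<omega>. (stack_norm n (drift t \<omega>))\<^sup>2 * cross t \<omega>) = 0"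
proof -
  have 1: "integrable M (\<lambda>\<omega>. inner (noise t \<omega> i) (drift t \<omega> i))"
      "expectation (\<lambda>\<omega>. inner (noise t \<omega> i) (drift t \<omega> i)) = 0" if i: "i < n" for i
  proof -
    note * = noise_orthogonal[OF i past_subset order_refl _ drift_history_measurable[OF i]
        has_fourth_moment_integrable_norm_mult[OF drift_fourth_moment[OF i] noise_fourth_moment[OF i]]]
    show "integrable M (\<lambda>\<omega>. inner (noise t \<omega> i) (drift t \<omega> i))"
      "expectation (\<lambda>\<omega>. inner (noise t \<omega> i) (drift t \<omega> i)) = 0"
      using * by (auto simp: past_def)
  qed
  show "integrable M (cross t)" "expectation (cross t) = 0"
    unfolding cross_def[abs_def] using 1
    by (auto intro: Bochner_Integration.integrable_sum simp: Bochner_Integration.integral_sum)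
  let ?Y = "\<lambda>i \<omega>. (stack_norm n (drift t \<omega>))\<^sup>2 *\<^sub>R drift t \<omega> i"
  have 2: "integrable M (\<lambda>\<omega>. inner (noise t \<omega> i) (?Y i \<omega>))"
      "expectation (\<lambda>\<omega>. inner (noise t \<omega> i) (?Y i \<omega>)) = 0" if i: "i < n" for i
  proof -
    have Y: "?Y i \<in> borel_measurable (history (past t))"
      by (intro borel_measurable_scaleR borel_measurable_power stack_norm_measurable drift_history_measurable i)
    then have [measurable]: "?Y i \<in> borel_measurable M"
      by (rule measurable_from_subalg[OF subalgebra_history[OF past_subset]])
    note [measurable] = noise_measurable[OF i]
    have int: "integrable M (\<lambda>\<omega>. norm (?Y i \<omega>) * norm (noise t \<omega> i))"
    proof (rule Bochner_Integration.integrable_bound)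
      show "integrable M (\<lambda>\<omega>. norm (stack_norm n (drift t \<omega>)) ^ 3 * norm (noise t \<omega> i))"
        by (intro has_fourth_moment_integrable_power3_mult stack_drift_fourth_moment noise_fourth_moment i)
      have "norm (?Y i \<omega>) * norm (noise t \<omega> i) \<le> stack_norm n (drift t \<omega>) ^ 3 * norm (noise t \<omega> i)" for \<omega>
        using norm_le_stack_norm[OF i, of "drift t \<omega>"]
        by (intro mult_right_mono) (auto simp: power3_eq_cube power2_eq_square intro!: mult_left_mono)
      then show "AE \<omega> in M. norm (norm (?Y i \<omega>) * norm (noise t \<omega> i))
          \<le> norm (norm (stack_norm n (drift t \<omega>)) ^ 3 * norm (noise t \<omega> i))"
        by (intro AE_I2) (simp add: stack_norm_nonneg)
    qed measurable
    note * = noise_orthogonal[OF i past_subset order_refl _ Y int]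
    show "integrable M (\<lambda>\<omega>. inner (noise t \<omega> i) (?Y i \<omega>))"
      "expectation (\<lambda>\<omega>. inner (noise t \<omega> i) (?Y i \<omega>)) = 0"
      using * by (auto simp: past_def)
  qed
  have eq: "(\<lambda>\<omega>. (stack_norm n (drift t \<omega>))\<^sup>2 * cross t \<omega>) = (\<lambda>\<omega>. \<Sum>i<n. inner (noise t \<omega> i) (?Y i \<omega>))"
    by (simp add: cross_def sum_distrib_left)
  show "integrable M (\<lambda>\<omega>. (stack_norm n (drift t \<omega>))\<^sup>2 * cross t \<omega>)"
    unfolding eq using 2(1) by (intro Bochner_Integration.integrable_sum) auto
  show "expectation (\<lambda>\<omega>. (stack_norm n (drift t \<omega>))\<^sup>2 * cross t \<omega>) = 0"
    unfolding eq using 2 by (subst Bochner_Integration.integral_sum) auto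
qed

lemma expectation_stack_noise_power2:
  "expectation (\<lambda>\<omega>. (stack_norm n (noise t \<omega>))\<^sup>2) \<le> real n * \<sigma>\<^sup>2"
proof -
  have "expectation (\<lambda>\<omega>. (stack_norm n (noise t \<omega>))\<^sup>2) = (\<Sum>i<n. expectation (\<lambda>\<omega>. (norm (noise t \<omega> i))\<^sup>2))"
    unfolding stack_norm_power2 using noise_moment2(1) by (subst Bochner_Integration.integral_sum) auto
  also have "\<dots> \<le> (\<Sum>i<n. \<sigma>\<^sup>2)" by (intro sum_mono noise_moment2) auto
  finally show ?thesis by simp
qed

lemma expectation_stack_noise_power4:
  "expectation (\<lambda>\<omega>. stack_norm n (noise t \<omega>) ^ 4) \<le> (real n)\<^sup>2 * \<sigma> ^ 4"
proof -
  have "expectation (\<lambda>\<omega>. stack_norm n (noise t \<omega>) ^ 4)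
      \<le> expectation (\<lambda>\<omega>. real n * (\<Sum>i<n. norm (noise t \<omega> i) ^ 4))"
  proof (rule integral_mono)
    show "integrable M (\<lambda>\<omega>. stack_norm n (noise t \<omega>) ^ 4)"
      using has_fourth_moment_integrable[OF stack_noise_fourth_moment] by simp
    show "integrable M (\<lambda>\<omega>. real n * (\<Sum>i<n. norm (noise t \<omega> i) ^ 4))"
      using noise_moment4(1) by (intro integrable_mult_right Bochner_Integration.integrable_sum) auto
  qed (rule power4_stack_norm_le)
  also have "\<dots> = real n * (\<Sum>i<n. expectation (\<lambda>\<omega>. norm (noise t \<omega> i) ^ 4))"
    using noise_moment4(1) by (simp add: Bochner_Integration.integral_sum)
  also have "\<dots> \<le> real n * (\<Sum>i<n. \<sigma> ^ 4)" by (intro mult_left_mono sum_mono noise_moment4) auto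
  finally show ?thesis by (simp add: power2_eq_square)
qed

lemma consensus_0: "consensus 0 \<omega> = 0"
proof -
  have "deviation 0 \<omega> i = 0" if "i < n" for i
    using init[OF that] by (simp add: deviation_def iterate_def mean_iterate_def)
  then have "(consensus 0 \<omega>)\<^sup>2 = 0" unfolding consensus_def stack_norm_power2 by simp
  then show ?thesis by simp
qed

lemma shrink_factor:
  shows "0 < 8 * \<rho> / 9" "8 * \<rho> / 9 \<le> 1"
  using rho by auto

text \<open>
  Since \<open>E[cross] = 0\<close>, the noise contributes only its variance.
\<close>

lemma consensus_second_moment_Suc:
  "expectation (\<lambda>\<omega>. (consensus (Suc t) \<omega>)\<^sup>2)
    \<le> (1 - 8 * \<rho> / 9) * expectation (\<lambda>\<omega>. (consensus t \<omega>)\<^sup>2)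
      + 9 / 8 * real n * \<gamma> (Suc t) ^ 2 * (\<sigma>\<^sup>2 + \<tau>\<^sup>2) / \<rho>"
proof -
  let ?g = "\<gamma> (Suc t)"
  have int_drift: "integrable M (\<lambda>\<omega>. (stack_norm n (drift t \<omega>))\<^sup>2)"
    using has_fourth_moment_integrable_norm_power2[OF stack_drift_fourth_moment] by simp
  have int_noise: "integrable M (\<lambda>\<omega>. (stack_norm n (noise t \<omega>))\<^sup>2)"
    using has_fourth_moment_integrable_norm_power2[OF stack_noise_fourth_moment] by simp
  have drift: "(stack_norm n (drift t \<omega>))\<^sup>2
      \<le> (1 - 8 * \<rho> / 9) * (consensus t \<omega>)\<^sup>2 + (?g * \<tau> * sqrt (real n))\<^sup>2 / (8 * \<rho> / 9)" for \<omega>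
    by (rule order_trans[OF power_mono[OF drift_le stack_norm_nonneg] contraction_power2_le[OF shrink_factor]])
  have "expectation (\<lambda>\<omega>. (consensus (Suc t) \<omega>)\<^sup>2)
      \<le> expectation (\<lambda>\<omega>. (stack_norm n (drift t \<omega>))\<^sup>2 - 2 * ?g * cross t \<omega> + ?g ^ 2 * (stack_norm n (noise t \<omega>))\<^sup>2)"
    by (intro integral_mono integrable_consensus_power2 consensus_power2_Suc_le Bochner_Integration.integrable_add
        Bochner_Integration.integrable_diff integrable_mult_right int_drift int_noise integrable_cross)
  also have "\<dots> = expectation (\<lambda>\<omega>. (stack_norm n (drift t \<omega>))\<^sup>2) + ?g ^ 2 * expectation (\<lambda>\<omega>. (stack_norm n (noise t \<omega>))\<^sup>2)"
    using int_drift int_noise integrable_cross expectation_cross by simp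
  also have "\<dots> \<le> expectation (\<lambda>\<omega>. (1 - 8 * \<rho> / 9) * (consensus t \<omega>)\<^sup>2 + (?g * \<tau> * sqrt (real n))\<^sup>2 / (8 * \<rho> / 9))
      + ?g ^ 2 * (real n * \<sigma>\<^sup>2)"
    by (intro add_mono integral_mono drift mult_left_mono expectation_stack_noise_power2 int_drift
        Bochner_Integration.integrable_add integrable_mult_right integrable_consensus_power2 integrable_const) auto
  also have "\<dots> = (1 - 8 * \<rho> / 9) * expectation (\<lambda>\<omega>. (consensus t \<omega>)\<^sup>2)
      + real n * ?g ^ 2 * (\<tau>\<^sup>2 * (9 / (8 * \<rho>)) + \<sigma>\<^sup>2)"
    using integrable_consensus_power2 by (simp add: prob_space power_mult_distrib algebra_simps)
  also have "\<dots> \<le> (1 - 8 * \<rho> / 9) * expectation (\<lambda>\<omega>. (consensus t \<omega>)\<^sup>2)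
      + real n * ?g ^ 2 * (\<tau>\<^sup>2 * (9 / (8 * \<rho>)) + \<sigma>\<^sup>2 * (9 / (8 * \<rho>)))"
  proof (intro add_left_mono mult_left_mono)
    have "1 \<le> 9 / (8 * \<rho>)" using rho by (simp add: field_simps)
    from mult_left_mono[OF this, of "\<sigma>\<^sup>2"] show "\<sigma>\<^sup>2 \<le> \<sigma>\<^sup>2 * (9 / (8 * \<rho>))" by simp
  qed simp
  also have "real n * ?g ^ 2 * (\<tau>\<^sup>2 * (9 / (8 * \<rho>)) + \<sigma>\<^sup>2 * (9 / (8 * \<rho>)))
      = 9 / 8 * real n * ?g ^ 2 * (\<sigma>\<^sup>2 + \<tau>\<^sup>2) / \<rho>"
    using rho by (simp add: field_simps)
  finally show ?thesis .
qed

text \<open>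
  Splitting the mixed term of the expansion costs a factor \<open>1 + \<rho> / 4\<close>, which leaves the contraction
  \<open>(1 + \<rho> / 4) (1 - 8 \<rho> / 9) \<le> 1 - 23 \<rho> / 36\<close>, and a multiple \<open>3 + 64 / \<rho> \<le> 67 / \<rho>\<^sup>3\<close> of the
  fourth moment of the noise.
\<close>

lemma consensus_fourth_moment_Suc:
  "expectation (\<lambda>\<omega>. consensus (Suc t) \<omega> ^ 4)
    \<le> (1 - 23 * \<rho> / 36) * expectation (\<lambda>\<omega>. consensus t \<omega> ^ 4)
      + 67 * (real n)\<^sup>2 * \<gamma> (Suc t) ^ 4 * (\<sigma> ^ 4 + 4 * \<tau> ^ 4) / \<rho> ^ 3"
proof -
  let ?g = "\<gamma> (Suc t)" and ?A = "expectation (\<lambda>\<omega>. consensus t \<omega> ^ 4)"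
  have A0: "?A \<ge> 0" by (intro Bochner_Integration.integral_nonneg) simp
  have int_drift: "integrable M (\<lambda>\<omega>. stack_norm n (drift t \<omega>) ^ 4)"
    using has_fourth_moment_integrable[OF stack_drift_fourth_moment] by simp
  have int_noise: "integrable M (\<lambda>\<omega>. stack_norm n (noise t \<omega>) ^ 4)"
    using has_fourth_moment_integrable[OF stack_noise_fourth_moment] by simp
  have drift: "stack_norm n (drift t \<omega>) ^ 4
      \<le> (1 - 8 * \<rho> / 9) * consensus t \<omega> ^ 4 + (?g * \<tau> * sqrt (real n)) ^ 4 / (8 * \<rho> / 9) ^ 3" for \<omega>
    by (rule order_trans[OF power_mono[OF drift_le stack_norm_nonneg] contraction_power4_le[OF shrink_factor]])
  have sqrt4: "sqrt (real n) ^ 4 = (real n)\<^sup>2"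
    by (simp add: power4_eq_xxxx power2_eq_square)
  have "expectation (\<lambda>\<omega>. stack_norm n (drift t \<omega>) ^ 4)
      \<le> expectation (\<lambda>\<omega>. (1 - 8 * \<rho> / 9) * consensus t \<omega> ^ 4 + (?g * \<tau> * sqrt (real n)) ^ 4 / (8 * \<rho> / 9) ^ 3)"
    by (intro integral_mono drift int_drift
        Bochner_Integration.integrable_add integrable_mult_right integrable_consensus_power4 integrable_const)
  also have "\<dots> = (1 - 8 * \<rho> / 9) * ?A + (real n)\<^sup>2 * ?g ^ 4 * (\<tau> ^ 4 * (729 / (512 * \<rho> ^ 3)))"
    using integrable_consensus_power4 rho
    by (simp add: prob_space power_mult_distrib sqrt4) (simp add: field_simps)
  finally have D: "expectation (\<lambda>\<omega>. stack_norm n (drift t \<omega>) ^ 4) \<le> \<dots>" .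
  have "expectation (\<lambda>\<omega>. consensus (Suc t) \<omega> ^ 4)
      \<le> expectation (\<lambda>\<omega>. (1 + \<rho> / 4) * stack_norm n (drift t \<omega>) ^ 4
      - 4 * ?g * ((stack_norm n (drift t \<omega>))\<^sup>2 * cross t \<omega>)
      + (3 + 64 / \<rho>) * ?g ^ 4 * stack_norm n (noise t \<omega>) ^ 4)"
    by (intro integral_mono integrable_consensus_power4 consensus_power4_Suc_le Bochner_Integration.integrable_add
        Bochner_Integration.integrable_diff integrable_mult_right int_drift int_noise integrable_power2_cross)
  also have "\<dots> = (1 + \<rho> / 4) * expectation (\<lambda>\<omega>. stack_norm n (drift t \<omega>) ^ 4)
      + (3 + 64 / \<rho>) * ?g ^ 4 * expectation (\<lambda>\<omega>. stack_norm n (noise t \<omega>) ^ 4)"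
    using int_drift int_noise integrable_power2_cross expectation_power2_cross by simp
  also have "\<dots> \<le> (1 + \<rho> / 4) * ((1 - 8 * \<rho> / 9) * ?A + (real n)\<^sup>2 * ?g ^ 4 * (\<tau> ^ 4 * (729 / (512 * \<rho> ^ 3))))
      + (3 + 64 / \<rho>) * ?g ^ 4 * ((real n)\<^sup>2 * \<sigma> ^ 4)"
    using rho by (intro add_mono mult_left_mono D expectation_stack_noise_power4) auto
  also have "\<dots> = (1 + \<rho> / 4) * (1 - 8 * \<rho> / 9) * ?A
      + (real n)\<^sup>2 * ?g ^ 4 * ((1 + \<rho> / 4) * (729 / (512 * \<rho> ^ 3)) * \<tau> ^ 4 + (3 + 64 / \<rho>) * \<sigma> ^ 4)"
    by (simp add: algebra_simps)
  also have "\<dots> \<le> (1 - 23 * \<rho> / 36) * ?A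
      + (real n)\<^sup>2 * ?g ^ 4 * (67 / \<rho> ^ 3 * (4 * \<tau> ^ 4) + 67 / \<rho> ^ 3 * \<sigma> ^ 4)"
  proof (intro add_mono mult_right_mono mult_left_mono A0)
    show "(1 + \<rho> / 4) * (1 - 8 * \<rho> / 9) \<le> 1 - 23 * \<rho> / 36"
      by (simp add: algebra_simps)
    have "(1 + \<rho> / 4) * (729 / (512 * \<rho> ^ 3)) \<le> 5 / 4 * (2 / \<rho> ^ 3)"
      using rho by (intro mult_mono) (auto simp: field_simps)
    also have "\<dots> \<le> 268 / \<rho> ^ 3" using rho by (simp add: field_simps)
    finally have "(1 + \<rho> / 4) * (729 / (512 * \<rho> ^ 3)) * \<tau> ^ 4 \<le> 268 / \<rho> ^ 3 * \<tau> ^ 4"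
      by (rule mult_right_mono) simp
    then show "(1 + \<rho> / 4) * (729 / (512 * \<rho> ^ 3)) * \<tau> ^ 4 \<le> 67 / \<rho> ^ 3 * (4 * \<tau> ^ 4)" by simp
    have "\<rho> ^ 3 \<le> \<rho>" using power_decreasing[of 1 3 \<rho>] rho by simp
    then have "3 + 64 / \<rho> \<le> 3 / \<rho> ^ 3 + 64 / \<rho> ^ 3"
      using rho by (intro add_mono divide_left_mono) (auto simp: field_simps power_le_one)
    then show "3 + 64 / \<rho> \<le> 67 / \<rho> ^ 3" by (simp add: add_divide_distrib[symmetric])
  qed auto
  also have "(real n)\<^sup>2 * ?g ^ 4 * (67 / \<rho> ^ 3 * (4 * \<tau> ^ 4) + 67 / \<rho> ^ 3 * \<sigma> ^ 4)
      = 67 * (real n)\<^sup>2 * ?g ^ 4 * (\<sigma> ^ 4 + 4 * \<tau> ^ 4) / \<rho> ^ 3"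
    using rho by (simp add: field_simps)
  finally show ?thesis .
qed

lemma step_ratio2:
  assumes t: "t \<ge> 1"
  shows "\<gamma> t ^ 2 * (1 - \<rho> / 2) \<le> (1 - \<rho> / 4) * \<gamma> (Suc t) ^ 2"
proof (rule power2_le_imp_le)
  have "(\<gamma> t ^ 2 * (1 - \<rho> / 2))\<^sup>2 = \<gamma> t ^ 4 * (1 - \<rho> / 2) * (1 - \<rho> / 2)"
    by (simp add: power2_eq_square power4_eq_xxxx)
  also have "\<dots> \<le> ((1 - \<rho> / 4) * \<gamma> (Suc t) ^ 4) * (1 - \<rho> / 4)"
    by (rule mult_mono[OF step_ratio[OF t]]) (use rho in auto)
  also have "\<dots> = ((1 - \<rho> / 4) * \<gamma> (Suc t) ^ 2)\<^sup>2"
    by (simp add: power2_eq_square power4_eq_xxxx)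
  finally show "(\<gamma> t ^ 2 * (1 - \<rho> / 2))\<^sup>2 \<le> ((1 - \<rho> / 4) * \<gamma> (Suc t) ^ 2)\<^sup>2" .
qed (use rho in auto)

text \<open>
  If \<open>A \<le> C u S\<close> has been improved to \<open>A \<le> K u S\<close> by a contraction step, the gain from \<open>C\<close> to \<open>K\<close> pays for replacing \<open>u\<close>, a
  power of the current step size, by the same power \<open>v\<close> of the next, possibly smaller one.
\<close>

lemma step_change_absorbed:
  assumes step: "u * (1 - \<rho> / 2) \<le> (1 - \<rho> / 4) * v" and u: "u \<ge> 0" and S: "S \<ge> 0"
    and A: "A \<le> K * u * S" and C: "C \<ge> 0" and K: "K * (1 - \<rho> / 4) \<le> C * (1 - \<rho> / 2)"
  shows "A \<le> C * v * S"
proof -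
  have pos: "1 - \<rho> / 4 > 0" using rho by auto
  have "(K * u) * (1 - \<rho> / 4) \<le> C * (u * (1 - \<rho> / 2))"
    using mult_right_mono[OF K u] by (simp add: mult_ac)
  also have "\<dots> \<le> C * ((1 - \<rho> / 4) * v)"
    by (rule mult_left_mono[OF step C])
  finally have "(K * u) * (1 - \<rho> / 4) \<le> (C * v) * (1 - \<rho> / 4)" by (simp add: mult_ac)
  then have "K * u \<le> C * v" by (rule mult_right_le_imp_le[OF _ pos])
  then have "K * u * S \<le> C * v * S" using S by (rule mult_right_mono)
  with A show ?thesis by simp
qed

text \<open>
  In the induction the previous bound, contracted by \<open>1 - 8 \<rho> / 9\<close> and increased by the new noise, must be at most
  \<open>(1 - \<rho> / 2) / (1 - \<rho> / 4)\<close> times the old one; the factor \<open>3\<close> is large enough for this. For the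
  fourth moment below, where the contraction is \<open>1 - 23 \<rho> / 36\<close>, so is \<open>388\<close>.
\<close>

lemma consensus_second_moment_le:
  "expectation (\<lambda>\<omega>. (consensus t \<omega>)\<^sup>2) \<le> 3 * \<gamma> (Suc t) ^ 2 * (real n * (\<sigma>\<^sup>2 + \<tau>\<^sup>2) / \<rho>\<^sup>2)"
proof (induction t)
  case 0
  show ?case using rho by (simp add: consensus_0)
next
  case (Suc t)
  let ?S = "real n * (\<sigma>\<^sup>2 + \<tau>\<^sup>2) / \<rho>\<^sup>2"
  define K where "K = (1 - 8 * \<rho> / 9) * 3 + 9 / 8 * \<rho>"
  show ?case
  proof (rule step_change_absorbed[OF step_ratio2[of "Suc t"], where K = K])
    have "expectation (\<lambda>\<omega>. (consensus (Suc t) \<omega>)\<^sup>2)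
      \<le> (1 - 8 * \<rho> / 9) * (3 * \<gamma> (Suc t) ^ 2 * ?S) + 9 / 8 * real n * \<gamma> (Suc t) ^ 2 * (\<sigma>\<^sup>2 + \<tau>\<^sup>2) / \<rho>"
      using rho by (intro order_trans[OF consensus_second_moment_Suc] add_right_mono mult_left_mono Suc) auto
    also have "9 / 8 * real n * \<gamma> (Suc t) ^ 2 * (\<sigma>\<^sup>2 + \<tau>\<^sup>2) / \<rho> = 9 / 8 * \<rho> * \<gamma> (Suc t) ^ 2 * ?S"
      using rho by (simp add: power2_eq_square)
    finally show "expectation (\<lambda>\<omega>. (consensus (Suc t) \<omega>)\<^sup>2) \<le> K * \<gamma> (Suc t) ^ 2 * ?S"
      unfolding K_def by (simp only: ring_distribs mult.assoc)
    have "37 / 96 * \<rho>\<^sup>2 \<le> 37 / 96 * \<rho>" using rho by (simp add: power2_eq_square mult_left_le)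
    then show "K * (1 - \<rho> / 4) \<le> 3 * (1 - \<rho> / 2)"
      using rho unfolding K_def by (simp add: algebra_simps power2_eq_square)
  qed (use rho in auto)
qed

lemma consensus_fourth_moment_le:
  "expectation (\<lambda>\<omega>. consensus t \<omega> ^ 4)
    \<le> 388 * \<gamma> (Suc t) ^ 4 * ((real n)\<^sup>2 * (\<sigma> ^ 4 + 4 * \<tau> ^ 4) / \<rho> ^ 4)"
proof (induction t)
  case 0
  show ?case using rho by (simp add: consensus_0)
next
  case (Suc t)
  let ?S = "(real n)\<^sup>2 * (\<sigma> ^ 4 + 4 * \<tau> ^ 4) / \<rho> ^ 4"
  define K where "K = (1 - 23 * \<rho> / 36) * 388 + 67 * \<rho>"
  show ?case
  proof (rule step_change_absorbed[OF step_ratio[of "Suc t"], where K = K])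
    have "expectation (\<lambda>\<omega>. consensus (Suc t) \<omega> ^ 4)
      \<le> (1 - 23 * \<rho> / 36) * (388 * \<gamma> (Suc t) ^ 4 * ?S)
        + 67 * (real n)\<^sup>2 * \<gamma> (Suc t) ^ 4 * (\<sigma> ^ 4 + 4 * \<tau> ^ 4) / \<rho> ^ 3"
      using rho by (intro order_trans[OF consensus_fourth_moment_Suc] add_right_mono mult_left_mono Suc) auto
    also have "67 * (real n)\<^sup>2 * \<gamma> (Suc t) ^ 4 * (\<sigma> ^ 4 + 4 * \<tau> ^ 4) / \<rho> ^ 3 = 67 * \<rho> * \<gamma> (Suc t) ^ 4 * ?S"
      using rho by (simp add: power3_eq_cube power4_eq_xxxx mult_ac)
    finally show "expectation (\<lambda>\<omega>. consensus (Suc t) \<omega> ^ 4) \<le> K * \<gamma> (Suc t) ^ 4 * ?S"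
      unfolding K_def by (simp only: ring_distribs mult.assoc)
    have "\<rho>\<^sup>2 \<le> \<rho>" using rho by (simp add: power2_eq_square mult_left_le)
    then show "K * (1 - \<rho> / 4) \<le> 388 * (1 - \<rho> / 2)"
      using rho unfolding K_def by (simp add: algebra_simps power2_eq_square)
  qed (use rho in auto)
qed

end

section \<open>Gradient bias and expected descent\<close>

context dsgd_consensus
begin

text \<open>
  Expand \<open>F i\<close> at the mean iterate. In the linear part the average Hessian may be subtracted, because deviations sum
  to zero; what remains is the Hessian heterogeneity \<open>h\<close> times the deviation. The second-order remainder is
  quadratic in the deviation. The two parts are combined with weights \<open>10\<close> and \<open>10 / 9\<close>, which fit the constants
  \<open>10 * 3 \<le> 32\<close> and \<open>10 / 9 * 388 \<le> 432\<close> of the final bound.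
\<close>

lemma gradient_bias_le:
  fixes H :: "nat \<Rightarrow> 'a \<Rightarrow> 'a \<Rightarrow>\<^sub>L 'a"
  assumes H: "\<And>i x. i < n \<Longrightarrow> (F i has_derivative blinfun_apply (H i x)) (at x)"
    and K: "K \<ge> 0" "\<And>i x y. i < n \<Longrightarrow> norm (H i y - H i x) \<le> K * norm (y - x)"
    and h: "h \<ge> 0" "\<And>i x. i < n \<Longrightarrow> norm (avg n (\<lambda>j. H j x) - H i x) \<le> h"
  shows "(norm (avg n (local_grad t \<omega>) - avg n (\<lambda>i. F i (mean_iterate t \<omega>))))\<^sup>2
    \<le> 10 * h\<^sup>2 * (consensus t \<omega>)\<^sup>2 / real n + 10 / 9 * K\<^sup>2 * consensus t \<omega> ^ 4 / (real n)\<^sup>2"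
proof -
  let ?m = "mean_iterate t \<omega>" and ?d = "deviation t \<omega>" and ?c = "consensus t \<omega>"
  define Hbar where "Hbar = avg n (\<lambda>j. H j ?m)"
  define R where "R i = F i (iterate t \<omega> i) - F i ?m - H i ?m (?d i)" for i
  define S where "S i = (Hbar - H i ?m) (?d i)" for i
  have avg_d: "avg n ?d = 0"
    unfolding avg_def sum_deviation by simp
  have "avg n (\<lambda>i. Hbar (?d i)) = Hbar (avg n ?d)"
    by (simp add: avg_def blinfun.scaleR_right blinfun.sum_right)
  then have avg_Hbar: "avg n (\<lambda>i. Hbar (?d i)) = 0"
    unfolding avg_d by simp
  have "local_grad t \<omega> i - F i ?m = (R i - S i) + Hbar (?d i)" for i
    by (simp add: R_def S_def local_grad_def blinfun.diff_left)
  then have "avg n (local_grad t \<omega>) - avg n (\<lambda>i. F i ?m) = avg n (\<lambda>i. (R i - S i) + Hbar (?d i))"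
    by (simp add: avg_diff[symmetric])
  then have eq: "avg n (local_grad t \<omega>) - avg n (\<lambda>i. F i ?m) = avg n R - avg n S"
    by (simp add: avg_add avg_diff avg_Hbar)
  have R: "norm (R i) \<le> K * (norm (?d i))\<^sup>2" if i: "i < n" for i
    unfolding R_def deviation_def
  proof (rule taylor1_remainder_le[where F' = "\<lambda>x. blinfun_apply (H i x)"])
    show "onorm (\<lambda>h. H i u h - H i ?m h) \<le> K * norm (u - ?m)" for u
      using K(2)[OF i, of u ?m] by (simp add: norm_blinfun.rep_eq minus_blinfun.rep_eq)
  qed (use H[OF i] K in auto)
  have "norm (avg n R) \<le> (\<Sum>i<n. K * (norm (?d i))\<^sup>2) / real n"
    by (rule order_trans[OF norm_avg_le divide_right_mono[OF sum_mono]]) (auto intro: R)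
  also have "\<dots> = K * ?c\<^sup>2 / real n"
    by (simp add: consensus_def stack_norm_power2 sum_distrib_left)
  finally have 1: "norm (avg n R) \<le> K * ?c\<^sup>2 / real n" .
  have S: "norm (S i) \<le> h * norm (?d i)" if i: "i < n" for i
    unfolding S_def Hbar_def
    by (rule order_trans[OF norm_blinfun mult_right_mono[OF h(2)[OF i]]]) simp
  have "norm (avg n S) \<le> (\<Sum>i<n. h * norm (?d i)) / real n"
    by (rule order_trans[OF norm_avg_le divide_right_mono[OF sum_mono]]) (auto intro: S)
  also have "\<dots> = h * (\<Sum>i<n. norm (?d i)) / real n" by (simp add: sum_distrib_left)
  also have "\<dots> \<le> h * (sqrt (real n) * ?c) / real n"
    unfolding consensus_def using h(1) by (intro divide_right_mono mult_left_mono sum_norm_le_stack_norm) auto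
  finally have 2: "norm (avg n S) \<le> h * (sqrt (real n) * ?c) / real n" .
  have young: "(a + b)\<^sup>2 \<le> 10 * a\<^sup>2 + 10 / 9 * b\<^sup>2" for a b :: real
    using zero_le_power2[of "3 * a - b / 3"] by (simp add: power2_eq_square algebra_simps)
  have "(norm (avg n R - avg n S))\<^sup>2 \<le> (norm (avg n S) + norm (avg n R))\<^sup>2"
    using norm_triangle_ineq4[of "avg n R" "avg n S"] by (intro power_mono) auto
  also have "\<dots> \<le> 10 * (norm (avg n S))\<^sup>2 + 10 / 9 * (norm (avg n R))\<^sup>2"
    by (rule young)
  also have "\<dots> \<le> 10 * (h * (sqrt (real n) * ?c) / real n)\<^sup>2 + 10 / 9 * (K * ?c\<^sup>2 / real n)\<^sup>2"
    by (intro add_mono mult_left_mono power_mono 1 2) auto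
  also have "\<dots> = 10 * h\<^sup>2 * ?c\<^sup>2 / real n + 10 / 9 * K\<^sup>2 * ?c ^ 4 / (real n)\<^sup>2"
    using n by (simp add: power_mult_distrib power_divide power2_eq_square[of "real n"])
  finally show ?thesis unfolding eq .
qed

lemma avg_F_lipschitz:
  "norm (avg n (\<lambda>i. F i y) - avg n (\<lambda>i. F i x)) \<le> L * norm (y - x)"
proof -
  have "norm (avg n (\<lambda>i. F i y - F i x)) \<le> (\<Sum>i<n. L * norm (y - x)) / real n"
    by (rule order_trans[OF norm_avg_le divide_right_mono[OF sum_mono]]) (auto intro: F_lipschitz)
  then show ?thesis using n by (simp add: avg_diff)
qed

lemma avg_F_measurable: "(\<lambda>x. avg n (\<lambda>i. F i x)) \<in> borel_measurable borel"
  by (intro avg_history_measurable F_measurable)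

lemma avg_F_mean_fourth_moment: "has_fourth_moment (\<lambda>\<omega>. avg n (\<lambda>i. F i (mean_iterate t \<omega>)))"
  by (intro has_fourth_moment_lipschitz[OF mean_iterate_fourth_moment, of "\<lambda>x. avg n (\<lambda>i. F i x)" L]
      avg_F_lipschitz L avg_F_measurable)

lemma avg_local_grad_fourth_moment: "has_fourth_moment (\<lambda>\<omega>. avg n (local_grad t \<omega>))"
  by (intro has_fourth_moment_avg local_grad_fourth_moment)

lemma avg_noise_fourth_moment: "has_fourth_moment (\<lambda>\<omega>. avg n (noise t \<omega>))"
  by (intro has_fourth_moment_avg noise_fourth_moment)

lemma expectation_avg_noise_inner:
  assumes Y: "Y \<in> borel_measurable (history (past t))" and mom: "has_fourth_moment Y"
  shows "expectation (\<lambda>\<omega>. inner (avg n (noise t \<omega>)) (Y \<omega>)) = 0"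
proof -
  have 1: "expectation (\<lambda>\<omega>. inner (noise t \<omega> i) (Y \<omega>)) = 0" if i: "i < n" for i
    using noise_orthogonal(2)[OF i past_subset order_refl _ Y
        has_fourth_moment_integrable_norm_mult[OF mom noise_fourth_moment[OF i]]]
    by (auto simp: past_def)
  have "expectation (\<lambda>\<omega>. \<Sum>i<n. inner (noise t \<omega> i) (Y \<omega>)) = (\<Sum>i<n. expectation (\<lambda>\<omega>. inner (noise t \<omega> i) (Y \<omega>)))"
    by (intro Bochner_Integration.integral_sum has_fourth_moment_integrable_inner noise_fourth_moment mom) auto
  then show ?thesis
    using 1 by (simp add: avg_def inner_sum_left)
qed

context
  fixes f :: "'a \<Rightarrow> real"
  assumes f_grad: "\<And>x. GDERIV f x :> avg n (\<lambda>i. F i x)"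
begin

lemma descent_inequality:
  "\<bar>f y - f x - inner (y - x) (avg n (\<lambda>i. F i x))\<bar> \<le> L * (norm (y - x))\<^sup>2"
  unfolding real_norm_def[symmetric]
proof (rule taylor1_remainder_le[where F' = "\<lambda>u h. inner h (avg n (\<lambda>i. F i u))"])
  show "(f has_derivative (\<lambda>h. inner h (avg n (\<lambda>i. F i u)))) (at u)" for u
    using f_grad[of u] unfolding gderiv_def .
  show "onorm (\<lambda>h. inner h (avg n (\<lambda>i. F i u)) - inner h (avg n (\<lambda>i. F i x))) \<le> L * norm (u - x)" for u
  proof (rule onorm_le)
    fix h
    have "norm (inner h (avg n (\<lambda>i. F i u) - avg n (\<lambda>i. F i x))) \<le> norm h * norm (avg n (\<lambda>i. F i u) - avg n (\<lambda>i. F i x))"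
      by (rule Cauchy_Schwarz_ineq2[folded real_norm_def])
    also have "\<dots> \<le> norm h * (L * norm (u - x))"
      by (intro mult_left_mono avg_F_lipschitz) simp
    finally show "norm (inner h (avg n (\<lambda>i. F i u)) - inner h (avg n (\<lambda>i. F i x))) \<le> L * norm (u - x) * norm h"
      by (simp add: inner_diff_right mult_ac)
  qed
qed (rule L)

lemma integrable_objective: "integrable M (\<lambda>\<omega>. f (mean_iterate t \<omega>))"
proof (rule Bochner_Integration.integrable_bound)
  let ?m = "mean_iterate t" and ?G = "avg n (\<lambda>i. F i 0)"
  show "integrable M (\<lambda>\<omega>. \<bar>f 0\<bar> + norm (?m \<omega>) * norm ?G + L * (norm (?m \<omega>))\<^sup>2)"
    by (intro Bochner_Integration.integrable_add integrable_const integrable_mult_right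
        has_fourth_moment_integrable_norm_mult has_fourth_moment_const mean_iterate_fourth_moment
        has_fourth_moment_integrable_norm_power2)
  have "\<bar>f x\<bar> \<le> \<bar>f 0\<bar> + norm x * norm ?G + L * (norm x)\<^sup>2" for x
    using descent_inequality[of x 0] Cauchy_Schwarz_ineq2[of x ?G] by simp
  then show "AE \<omega> in M. norm (f (?m \<omega>)) \<le> norm (\<bar>f 0\<bar> + norm (?m \<omega>) * norm ?G + L * (norm (?m \<omega>))\<^sup>2)"
    using L by (intro AE_I2) simp
  have "continuous_on UNIV f"
    using f_grad unfolding gderiv_def
    by (meson has_derivative_continuous continuous_at_imp_continuous_on)
  from measurable_compose[OF has_fourth_moment_measurable[OF mean_iterate_fourth_moment]
      borel_measurable_continuous_onI[OF this]]
  show "(\<lambda>\<omega>. f (?m \<omega>)) \<in> borel_measurable M" .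
qed

text \<open>
  The polarisation identity turns \<open>- s A \<bullet> G\<close> into a descent term, the squared bias \<open>|A - G|\<^sup>2\<close>, and a negative
  multiple of \<open>|A|\<^sup>2\<close> that absorbs the quadratic term as \<open>s L \<le> 1 / 9\<close>. Everything linear in the noise is collected in one
  inner product with a quantity of the past.
\<close>

lemma objective_Suc_le:
  fixes t \<omega>
  defines "G \<equiv> avg n (\<lambda>i. F i (mean_iterate t \<omega>))" and "A \<equiv> avg n (local_grad t \<omega>)"
    and "N \<equiv> avg n (noise t \<omega>)" and "s \<equiv> \<gamma> (Suc t)"
  shows "f (mean_iterate (Suc t) \<omega>) \<le> f (mean_iterate t \<omega>) - s / 2 * (norm G)\<^sup>2 + s / 2 * (norm (A - G))\<^sup>2
    + L * s\<^sup>2 * (norm N)\<^sup>2 + inner N ((2 * L * s\<^sup>2) *\<^sub>R A - s *\<^sub>R G)"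
proof -
  have s: "s > 0" and sL: "s * L \<le> 1 / 9"
    unfolding s_def using step_pos[of "Suc t"] step_L[of "Suc t"] rho by auto
  have "f (mean_iterate (Suc t) \<omega>) - f (mean_iterate t \<omega>) - inner (- (s *\<^sub>R (A + N))) G \<le> L * (norm (- (s *\<^sub>R (A + N))))\<^sup>2"
    using descent_inequality[of "mean_iterate (Suc t) \<omega>" "mean_iterate t \<omega>"]
    unfolding mean_iterate_Suc G_def A_def N_def s_def by (simp add: abs_le_iff)
  then have "f (mean_iterate (Suc t) \<omega>) \<le> f (mean_iterate t \<omega>) - s * inner A G - s * inner N G
      + L * s\<^sup>2 * ((norm A)\<^sup>2 + 2 * inner N A + (norm N)\<^sup>2)"
    by (simp add: power_mult_distrib power2_norm_eq_inner inner_add_left inner_add_right inner_commute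
        power2_eq_square[of s] algebra_simps)
  moreover have "(norm (A - G))\<^sup>2 = (norm A)\<^sup>2 - 2 * inner A G + (norm G)\<^sup>2"
    by (simp add: power2_norm_eq_inner inner_diff_left inner_diff_right inner_commute)
  then have dist: "s / 2 * (norm (A - G))\<^sup>2 = s / 2 * ((norm A)\<^sup>2 - 2 * inner A G + (norm G)\<^sup>2)" by simp
  have "- (s * inner A G) = s / 2 * (norm (A - G))\<^sup>2 - s / 2 * (norm A)\<^sup>2 - s / 2 * (norm G)\<^sup>2"
    unfolding dist by (simp add: algebra_simps)
  moreover have "L * s\<^sup>2 * (norm A)\<^sup>2 \<le> s / 2 * (norm A)\<^sup>2"
  proof (rule mult_right_mono)
    have "(s * L) * s \<le> (1 / 2) * s" using s sL by (intro mult_right_mono) auto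
    then show "L * s\<^sup>2 \<le> s / 2" by (simp add: power2_eq_square mult_ac)
  qed simp
  moreover have "inner N ((2 * L * s\<^sup>2) *\<^sub>R A - s *\<^sub>R G) = 2 * (L * s\<^sup>2) * inner N A - s * inner N G"
    by (simp add: inner_diff_right)
  ultimately show ?thesis by (simp add: distrib_left)
qed

lemma expected_descent:
  shows "integrable M (\<lambda>\<omega>. (norm (avg n (\<lambda>i. F i (mean_iterate t \<omega>))))\<^sup>2)"
    and "\<gamma> (Suc t) * expectation (\<lambda>\<omega>. (norm (avg n (\<lambda>i. F i (mean_iterate t \<omega>))))\<^sup>2)
      \<le> 2 * (expectation (\<lambda>\<omega>. f (mean_iterate t \<omega>)) - expectation (\<lambda>\<omega>. f (mean_iterate (Suc t) \<omega>)))
        + \<gamma> (Suc t) * expectation (\<lambda>\<omega>. (norm (avg n (local_grad t \<omega>) - avg n (\<lambda>i. F i (mean_iterate t \<omega>))))\<^sup>2)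
        + 2 * L * \<gamma> (Suc t) ^ 2 * (\<sigma>\<^sup>2 / real n)"
proof -
  define G where "G \<omega> = avg n (\<lambda>i. F i (mean_iterate t \<omega>))" for \<omega>
  define A where "A \<omega> = avg n (local_grad t \<omega>)" for \<omega>
  define N where "N \<omega> = avg n (noise t \<omega>)" for \<omega>
  define s where "s = \<gamma> (Suc t)"
  define Y where "Y \<omega> = (2 * L * s\<^sup>2) *\<^sub>R A \<omega> - s *\<^sub>R G \<omega>" for \<omega>
  have mG: "has_fourth_moment G" and mA: "has_fourth_moment A" and mN: "has_fourth_moment N"
    unfolding G_def[abs_def] A_def[abs_def] N_def[abs_def]
    by (rule avg_F_mean_fourth_moment avg_local_grad_fourth_moment avg_noise_fourth_moment)+
  have mY: "has_fourth_moment Y"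
    unfolding Y_def[abs_def] by (intro has_fourth_moment_diff has_fourth_moment_scaleR mA mG)
  have iG: "integrable M (\<lambda>\<omega>. (norm (G \<omega>))\<^sup>2)" and iE: "integrable M (\<lambda>\<omega>. (norm (A \<omega> - G \<omega>))\<^sup>2)"
    and iN: "integrable M (\<lambda>\<omega>. (norm (N \<omega>))\<^sup>2)" and iY: "integrable M (\<lambda>\<omega>. inner (N \<omega>) (Y \<omega>))"
    by (intro has_fourth_moment_integrable_norm_power2 has_fourth_moment_integrable_inner
        has_fourth_moment_diff mG mA mN mY)+
  show "integrable M (\<lambda>\<omega>. (norm (avg n (\<lambda>i. F i (mean_iterate t \<omega>))))\<^sup>2)"
    using iG unfolding G_def .
  have zero: "expectation (\<lambda>\<omega>. inner (N \<omega>) (Y \<omega>)) = 0"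
    unfolding N_def
  proof (rule expectation_avg_noise_inner[OF _ mY])
    have "A \<in> borel_measurable (history (past t))"
      unfolding A_def[abs_def]
      by (intro avg_history_measurable local_grad_history_measurable past_subset order_refl)
    moreover have "G \<in> borel_measurable (history (past t))"
      unfolding G_def[abs_def]
      by (rule measurable_compose[OF mean_iterate_history_measurable avg_F_measurable])
    ultimately show "Y \<in> borel_measurable (history (past t))"
      unfolding Y_def[abs_def] by measurable
  qed
  have "expectation (\<lambda>\<omega>. f (mean_iterate (Suc t) \<omega>)) \<le> expectation (\<lambda>\<omega>. f (mean_iterate t \<omega>)
      - s / 2 * (norm (G \<omega>))\<^sup>2 + s / 2 * (norm (A \<omega> - G \<omega>))\<^sup>2 + L * s\<^sup>2 * (norm (N \<omega>))\<^sup>2 + inner (N \<omega>) (Y \<omega>))"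
  proof (rule integral_mono)
    show "f (mean_iterate (Suc t) \<omega>) \<le> f (mean_iterate t \<omega>)
      - s / 2 * (norm (G \<omega>))\<^sup>2 + s / 2 * (norm (A \<omega> - G \<omega>))\<^sup>2 + L * s\<^sup>2 * (norm (N \<omega>))\<^sup>2 + inner (N \<omega>) (Y \<omega>)" for \<omega>
      unfolding G_def A_def N_def Y_def s_def by (rule objective_Suc_le)
  qed (intro Bochner_Integration.integrable_add Bochner_Integration.integrable_diff integrable_mult_right
      integrable_objective iG iE iN iY)+
  also have "\<dots> = expectation (\<lambda>\<omega>. f (mean_iterate t \<omega>)) - s / 2 * expectation (\<lambda>\<omega>. (norm (G \<omega>))\<^sup>2)
      + s / 2 * expectation (\<lambda>\<omega>. (norm (A \<omega> - G \<omega>))\<^sup>2) + L * s\<^sup>2 * expectation (\<lambda>\<omega>. (norm (N \<omega>))\<^sup>2)"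
    using integrable_objective[of t] iG iE iN iY zero by simp
  also have "\<dots> \<le> expectation (\<lambda>\<omega>. f (mean_iterate t \<omega>)) - s / 2 * expectation (\<lambda>\<omega>. (norm (G \<omega>))\<^sup>2)
      + s / 2 * expectation (\<lambda>\<omega>. (norm (A \<omega> - G \<omega>))\<^sup>2) + L * s\<^sup>2 * (\<sigma>\<^sup>2 / real n)"
    unfolding N_def using L by (intro add_left_mono mult_left_mono expectation_norm_avg_noise_le) auto
  finally show "\<gamma> (Suc t) * expectation (\<lambda>\<omega>. (norm (avg n (\<lambda>i. F i (mean_iterate t \<omega>))))\<^sup>2)
      \<le> 2 * (expectation (\<lambda>\<omega>. f (mean_iterate t \<omega>)) - expectation (\<lambda>\<omega>. f (mean_iterate (Suc t) \<omega>)))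
        + \<gamma> (Suc t) * expectation (\<lambda>\<omega>. (norm (avg n (local_grad t \<omega>) - avg n (\<lambda>i. F i (mean_iterate t \<omega>))))\<^sup>2)
        + 2 * L * \<gamma> (Suc t) ^ 2 * (\<sigma>\<^sup>2 / real n)"
    unfolding G_def A_def s_def by (simp add: field_simps)
qed

text \<open>
  Telescoping the expected descent and inserting the moment bounds for the consensus error into the bias.
\<close>

lemma sum_gradient_bound:
  fixes H :: "nat \<Rightarrow> 'a \<Rightarrow> 'a \<Rightarrow>\<^sub>L 'a"
  assumes H: "\<And>i x. i < n \<Longrightarrow> (F i has_derivative blinfun_apply (H i x)) (at x)"
    and K: "K \<ge> 0" "\<And>i x y. i < n \<Longrightarrow> norm (H i y - H i x) \<le> K * norm (y - x)"
    and h: "h \<ge> 0" "\<And>i x. i < n \<Longrightarrow> norm (avg n (\<lambda>j. H j x) - H i x) \<le> h"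
    and lower: "\<And>x. f x \<ge> f_low"
  shows "integrable M (\<lambda>\<omega>. \<Sum>t<T. \<gamma> (t + 1) * (norm (avg n (\<lambda>i. F i (mean_iterate t \<omega>))))\<^sup>2)"
    and "expectation (\<lambda>\<omega>. \<Sum>t<T. \<gamma> (t + 1) * (norm (avg n (\<lambda>i. F i (mean_iterate t \<omega>))))\<^sup>2)
      \<le> 2 * (f (avg n \<theta>0) - f_low) + 2 * L * \<sigma>\<^sup>2 / real n * (\<Sum>t<T. \<gamma> (t + 1) ^ 2)
        + 432 * K\<^sup>2 / \<rho> ^ 4 * (\<sigma> ^ 4 + 4 * \<tau> ^ 4) * (\<Sum>t<T. \<gamma> (t + 1) ^ 5)
        + 30 * h\<^sup>2 * (\<sigma>\<^sup>2 + \<tau>\<^sup>2) / \<rho>\<^sup>2 * (\<Sum>t<T. \<gamma> (t + 1) ^ 3)"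
proof -
  let ?G = "\<lambda>t \<omega>. (norm (avg n (\<lambda>i. F i (mean_iterate t \<omega>))))\<^sup>2"
  let ?f = "\<lambda>t. expectation (\<lambda>\<omega>. f (mean_iterate t \<omega>))"
  define a where "a = 2 * L * \<sigma>\<^sup>2 / real n"
  define b where "b = 432 * K\<^sup>2 / \<rho> ^ 4 * (\<sigma> ^ 4 + 4 * \<tau> ^ 4)"
  define c where "c = 30 * h\<^sup>2 * (\<sigma>\<^sup>2 + \<tau>\<^sup>2) / \<rho>\<^sup>2"
  show "integrable M (\<lambda>\<omega>. \<Sum>t<T. \<gamma> (t + 1) * ?G t \<omega>)"
    by (intro Bochner_Integration.integrable_sum integrable_mult_right expected_descent(1))
  have step: "\<gamma> (t + 1) * expectation (?G t)
      \<le> 2 * (?f t - ?f (Suc t)) + (a * \<gamma> (t + 1) ^ 2 + b * \<gamma> (t + 1) ^ 5 + c * \<gamma> (t + 1) ^ 3)" for t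
  proof -
    let ?s = "\<gamma> (Suc t)"
    let ?e = "\<lambda>\<omega>. (norm (avg n (local_grad t \<omega>) - avg n (\<lambda>i. F i (mean_iterate t \<omega>))))\<^sup>2"
    have s: "?s > 0" by (rule step_pos) simp
    have "expectation ?e \<le> expectation (\<lambda>\<omega>. 10 * h\<^sup>2 / real n * (consensus t \<omega>)\<^sup>2
        + 10 / 9 * K\<^sup>2 / (real n)\<^sup>2 * consensus t \<omega> ^ 4)"
    proof (rule integral_mono)
      show "integrable M ?e"
        by (intro has_fourth_moment_integrable_norm_power2 has_fourth_moment_diff
            avg_F_mean_fourth_moment avg_local_grad_fourth_moment)
      show "integrable M (\<lambda>\<omega>. 10 * h\<^sup>2 / real n * (consensus t \<omega>)\<^sup>2 + 10 / 9 * K\<^sup>2 / (real n)\<^sup>2 * consensus t \<omega> ^ 4)"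
        by (intro Bochner_Integration.integrable_add integrable_mult_right
            integrable_consensus_power2 integrable_consensus_power4)
      show "?e \<omega> \<le> 10 * h\<^sup>2 / real n * (consensus t \<omega>)\<^sup>2 + 10 / 9 * K\<^sup>2 / (real n)\<^sup>2 * consensus t \<omega> ^ 4" for \<omega>
        using gradient_bias_le[OF H K h, of t \<omega>] by simp
    qed
    also have "\<dots> = 10 * h\<^sup>2 / real n * expectation (\<lambda>\<omega>. (consensus t \<omega>)\<^sup>2)
        + 10 / 9 * K\<^sup>2 / (real n)\<^sup>2 * expectation (\<lambda>\<omega>. consensus t \<omega> ^ 4)"
      using integrable_consensus_power2 integrable_consensus_power4 by simp
    also have "\<dots> \<le> 10 * h\<^sup>2 / real n * (3 * ?s ^ 2 * (real n * (\<sigma>\<^sup>2 + \<tau>\<^sup>2) / \<rho>\<^sup>2))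
        + 10 / 9 * K\<^sup>2 / (real n)\<^sup>2 * (388 * ?s ^ 4 * ((real n)\<^sup>2 * (\<sigma> ^ 4 + 4 * \<tau> ^ 4) / \<rho> ^ 4))"
      by (intro add_mono mult_left_mono consensus_second_moment_le consensus_fourth_moment_le) auto
    also have "\<dots> = c * ?s ^ 2 + 3880 / 9 * (K\<^sup>2 / \<rho> ^ 4 * (\<sigma> ^ 4 + 4 * \<tau> ^ 4) * ?s ^ 4)"
      using n rho by (simp add: c_def field_simps)
    also have "\<dots> \<le> c * ?s ^ 2 + 432 * (K\<^sup>2 / \<rho> ^ 4 * (\<sigma> ^ 4 + 4 * \<tau> ^ 4) * ?s ^ 4)"
      by (intro add_left_mono mult_right_mono mult_nonneg_nonneg) auto
    also have "\<dots> = c * ?s ^ 2 + b * ?s ^ 4" by (simp add: b_def)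
    finally have "?s * expectation ?e \<le> ?s * (c * ?s ^ 2 + b * ?s ^ 4)"
      using s by (intro mult_left_mono) auto
    also have "\<dots> = b * ?s ^ 5 + c * ?s ^ 3"
      by (simp add: algebra_simps eval_nat_numeral)
    finally show ?thesis
      using expected_descent(2)[of t] by (simp add: a_def mult_ac)
  qed
  have "expectation (\<lambda>\<omega>. \<Sum>t<T. \<gamma> (t + 1) * ?G t \<omega>) = (\<Sum>t<T. \<gamma> (t + 1) * expectation (?G t))"
    using expected_descent(1) by (subst Bochner_Integration.integral_sum) auto
  also have "\<dots> \<le> (\<Sum>t<T. 2 * (?f t - ?f (Suc t)) + (a * \<gamma> (t + 1) ^ 2 + b * \<gamma> (t + 1) ^ 5 + c * \<gamma> (t + 1) ^ 3))"
    by (rule sum_mono) (rule step)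
  also have "\<dots> = 2 * (?f 0 - ?f T) + a * (\<Sum>t<T. \<gamma> (t + 1) ^ 2) + b * (\<Sum>t<T. \<gamma> (t + 1) ^ 5) + c * (\<Sum>t<T. \<gamma> (t + 1) ^ 3)"
    unfolding sum.distrib sum_distrib_left[symmetric]
    by (subst sum_lessThan_telescope') simp
  also have "?f 0 = f (avg n \<theta>0)"
    by (simp add: mean_iterate_def iterate_def prob_space)
  finally have *: "expectation (\<lambda>\<omega>. \<Sum>t<T. \<gamma> (t + 1) * ?G t \<omega>) \<le> 2 * (f (avg n \<theta>0) - ?f T)
      + a * (\<Sum>t<T. \<gamma> (t + 1) ^ 2) + b * (\<Sum>t<T. \<gamma> (t + 1) ^ 5) + c * (\<Sum>t<T. \<gamma> (t + 1) ^ 3)" .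
  have "expectation (\<lambda>\<omega>. f_low) \<le> ?f T"
    by (intro integral_mono integrable_const integrable_objective lower)
  then have "f_low \<le> ?f T" by (simp add: prob_space)
  then have "2 * (f (avg n \<theta>0) - ?f T) \<le> 2 * (f (avg n \<theta>0) - f_low)" by simp
  from order_trans[OF * add_right_mono[OF add_right_mono[OF add_right_mono[OF this]]]]
  show "expectation (\<lambda>\<omega>. \<Sum>t<T. \<gamma> (t + 1) * ?G t \<omega>)
      \<le> 2 * (f (avg n \<theta>0) - f_low) + 2 * L * \<sigma>\<^sup>2 / real n * (\<Sum>t<T. \<gamma> (t + 1) ^ 2)
        + 432 * K\<^sup>2 / \<rho> ^ 4 * (\<sigma> ^ 4 + 4 * \<tau> ^ 4) * (\<Sum>t<T. \<gamma> (t + 1) ^ 5)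
        + 30 * h\<^sup>2 * (\<sigma>\<^sup>2 + \<tau>\<^sup>2) / \<rho>\<^sup>2 * (\<Sum>t<T. \<gamma> (t + 1) ^ 3)"
    unfolding a_def b_def c_def .
qed

end

end


section \<open>The convergence bound\<close>

lemma GDERIV_global_obj:
  fixes l :: "'a::euclidean_space \<Rightarrow> 'z \<Rightarrow> real"
  assumes "\<And>i. i < n \<Longrightarrow> local_obj B l i differentiable at x"
  shows "GDERIV (global_obj n B l) x :> avg n (\<lambda>i. grad (local_obj B l i) x)"
proof -
  have "((\<lambda>x. (\<Sum>i<n. local_obj B l i x) / real n) has_derivative
      (\<lambda>h. (\<Sum>i<n. inner h (grad (local_obj B l i) x)) / real n)) (at x)"
    using GDERIV_grad[OF assms] unfolding gderiv_def
    by (intro bounded_linear.has_derivative[OF bounded_linear_divide] has_derivative_sum) auto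
  then show ?thesis
    unfolding gderiv_def global_obj_def[abs_def] avg_def by (simp add: inner_sum_right)
qed

lemma has_derivative_grad_hessian:
  fixes f :: "'a::euclidean_space \<Rightarrow> real"
  assumes "grad f differentiable at x"
  shows "(grad f has_derivative blinfun_apply (hessian f x)) (at x)"
proof -
  have "(grad f has_derivative frechet_derivative (grad f) (at x)) (at x)"
    using assms by (simp add: frechet_derivative_works)
  then show ?thesis
    unfolding hessian_def by (simp add: has_derivative_bounded_linear bounded_linear_Blinfun_apply)
qed

lemma has_derivative_imp_hessian:
  fixes f :: "'a::euclidean_space \<Rightarrow> real"
  assumes "(grad f has_derivative blinfun_apply H) (at x)"
  shows "hessian f x = H"
  unfolding hessian_def frechet_derivative_at[OF assms, symmetric]
  by (rule blinfun_apply_inverse)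

text \<open>
  The objective \<open>f\<close> inherits gradient and Hessian from the local objectives by averaging, so the result is the
  previous bound for the gradient fields of the local objectives; each of its terms is at most the stated one
  because \<open>D\<close> is nonnegative and \<open>n \<ge> 1\<close>.
\<close>

theorem theorem2:
  fixes n :: nat
    and Z :: "'z measure" and B :: "nat \<Rightarrow> 'z measure"
    and l :: "real ^ 'd \<Rightarrow> 'z \<Rightarrow> real"
    and E :: "(nat \<times> nat) set" and W U :: "real Matrix.mat"
    and M :: "'w measure" and \<zeta> :: "nat \<Rightarrow> nat \<Rightarrow> 'w \<Rightarrow> 'z"
    and \<gamma> :: "nat \<Rightarrow> real" and \<theta>0 :: "nat \<Rightarrow> real ^ 'd"
    and \<rho> L \<sigma> \<tau> L\<^sub>H \<tau>\<^sub>H b f_star D :: real and T :: nat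
    and f :: "real ^ 'd \<Rightarrow> real" and fi :: "nat \<Rightarrow> real ^ 'd \<Rightarrow> real"
    and \<theta> :: "nat \<Rightarrow> 'w \<Rightarrow> nat \<Rightarrow> real ^ 'd" and \<theta>_bar :: "nat \<Rightarrow> 'w \<Rightarrow> real ^ 'd"
  assumes n: "n \<ge> 1"
    \<comment> \<open>data distributions and objectives\<close>
    and B_prob: "\<And>i. i < n \<Longrightarrow> prob_space (B i)"
    and B_sets: "\<And>i. i < n \<Longrightarrow> sets (B i) = sets Z"
    and l_integrable: "\<And>i x. i < n \<Longrightarrow> integrable (B i) (l x)"
    and l_diff: "\<And>z x. z \<in> space Z \<Longrightarrow> (\<lambda>y. l y z) differentiable at x"
    and fi_def: "fi = local_obj B l"
    and f_def: "f = global_obj n B l"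
    and f_bdd: "bdd_below (range f)"
    and f_star_def: "f_star = (INF x. f x)"
    \<comment> \<open>communication graph and mixing matrix\<close>
    and graph: "comm_graph n E"
    and mixing: "mixing_matrix n E W"
    \<comment> \<open>samples, step sizes and the algorithm\<close>
    and M_prob: "prob_space M"
    and \<zeta>_indep: "prob_space.indep_vars M (\<lambda>_. Z) (\<lambda>(i, t). \<zeta> i t) ({..<n} \<times> {1..})"
    and \<zeta>_distr: "\<And>i t. i < n \<Longrightarrow> t \<ge> 1 \<Longrightarrow> distr M Z (\<zeta> i t) = B i"
    and \<gamma>_pos: "\<And>t. t \<ge> 1 \<Longrightarrow> \<gamma> t > 0"
    and \<theta>_def: "\<theta> = (\<lambda>t \<omega>. dsgd n W \<gamma> l \<theta>0 (\<lambda>i s. \<zeta> i s \<omega>) t)"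
    and \<theta>_bar_def: "\<theta>_bar = (\<lambda>t \<omega>. avg n (\<theta> t \<omega>))"
    and A1_stochastic: "W *\<^sub>v ones_vec n = ones_vec n" "transpose_mat W *\<^sub>v ones_vec n = ones_vec n"
    and A1_rho: "0 < \<rho>" "\<rho> \<le> 1"
    and A1_U: "U \<in> carrier_mat n (n - 1)"
      "1\<^sub>m n - (1 / real n) \<cdot>\<^sub>m ones_mat n = U * transpose_mat U"
    and A1_gap: "spectral_norm (transpose_mat U * W * U) \<le> 1 - \<rho>"
    and A2: "L \<ge> 0"
      "\<And>i x y. i < n \<Longrightarrow> norm (grad (fi i) y - grad (fi i) x) \<le> L * norm (y - x)"
    and A3: "\<sigma> \<ge> 0"
      "\<And>i x. i < n \<Longrightarrow> has_bochner_integral (B i) (grad_loss l x) (grad (fi i) x)"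
      "\<And>i x. i < n \<Longrightarrow> integrable (B i) (\<lambda>z. norm (grad_loss l x z - grad (fi i) x) ^ 2)"
      "\<And>i x. i < n \<Longrightarrow> (\<integral>z. norm (grad_loss l x z - grad (fi i) x) ^ 2 \<partial>B i) \<le> \<sigma> ^ 2"
    and A4: "\<tau> \<ge> 0" "\<And>i x. i < n \<Longrightarrow> norm (grad f x - grad (fi i) x) \<le> \<tau>"
    and A5: "L\<^sub>H \<ge> 0" "\<And>i. i < n \<Longrightarrow> twice_continuously_differentiable (fi i)"
      "\<And>i x y. i < n \<Longrightarrow> norm (hessian (fi i) y - hessian (fi i) x) \<le> L\<^sub>H * norm (y - x)"
    and A6: "\<tau>\<^sub>H \<ge> 0" "\<And>i x. i < n \<Longrightarrow> norm (hessian f x - hessian (fi i) x) \<le> \<tau>\<^sub>H"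
    and A7: \<comment> \<open>unbiasedness is already part of A3\<close>
      "\<And>i x. i < n \<Longrightarrow> integrable (B i) (\<lambda>z. norm (grad_loss l x z - grad (fi i) x) ^ 4)"
      "\<And>i x. i < n \<Longrightarrow> (\<integral>z. norm (grad_loss l x z - grad (fi i) x) ^ 4 \<partial>B i) \<le> \<sigma> ^ 4"
    and init: "\<And>i j. i < n \<Longrightarrow> j < n \<Longrightarrow> \<theta>0 i = \<theta>0 j"
    and b: "b > 0"
    \<comment> \<open>the bound \<open>\<rho> / (9 L)\<close> is read as infinite for \<open>L = 0\<close>\<close>
    and \<gamma>_bound: "\<And>t. t \<ge> 1 \<Longrightarrow> L > 0 \<Longrightarrow> \<gamma> t \<le> \<rho> / (9 * L)"
      "\<And>t. t \<ge> 1 \<Longrightarrow> \<gamma> t \<le> min (sqrt ((\<rho> / (4 * b)) / (1 - \<rho> / 2))) (root 4 ((\<rho> / (4 * b)) / (1 - \<rho> / 2)))"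
    and \<gamma>_ratio: "\<And>t. t \<ge> 1 \<Longrightarrow> \<gamma> t ^ 4 / \<gamma> (t + 1) ^ 4 \<le> 1 + b * \<gamma> (t + 1) ^ 4"
    and D_def: "D = f (avg n \<theta>0) - f_star"
    and T: "T \<ge> 1"
  shows "integrable M (\<lambda>\<omega>. \<Sum>t<T. \<gamma> (t + 1) * norm (grad f (\<theta>_bar t \<omega>)) ^ 2) \<and>
    (\<integral>\<omega>. (\<Sum>t<T. \<gamma> (t + 1) * norm (grad f (\<theta>_bar t \<omega>)) ^ 2) \<partial>M)
      \<le> 4 * D + 2 * L * \<sigma> ^ 2 / real n * (\<Sum>t<T. \<gamma> (t + 1) ^ 2)
        + 432 * real n * L\<^sub>H ^ 2 / \<rho> ^ 4 * (\<sigma> ^ 4 + 4 * \<tau> ^ 4) * (\<Sum>t<T. \<gamma> (t + 1) ^ 5)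
        + 32 * \<tau>\<^sub>H ^ 2 * (\<sigma> ^ 2 + \<tau> ^ 2) / \<rho> ^ 2 * (\<Sum>t<T. \<gamma> (t + 1) ^ 3)"
proof -
  define F where "F i = grad (fi i)" for i
  have fi_diff: "fi i differentiable at x" and F_diff: "grad (fi i) differentiable at x" if "i < n" for i x
    using A5(2)[OF that] unfolding twice_continuously_differentiable_def by auto
  have F_der: "(F i has_derivative blinfun_apply (hessian (fi i) x)) (at x)" if "i < n" for i x
    unfolding F_def by (rule has_derivative_grad_hessian[OF F_diff[OF that]])
  have f_grad: "GDERIV f x :> avg n (\<lambda>i. F i x)" for x
    using GDERIV_global_obj[of n B l x] fi_diff unfolding f_def fi_def F_def by simp
  have grad_f: "grad f x = avg n (\<lambda>i. F i x)" for x
    by (rule GDERIV_imp_grad[OF f_grad])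
  have hessian_f: "hessian f x = avg n (\<lambda>i. hessian (fi i) x)" for x
  proof (rule has_derivative_imp_hessian)
    have "((\<lambda>x. (1 / real n) *\<^sub>R (\<Sum>i<n. F i x)) has_derivative
        (\<lambda>h. (1 / real n) *\<^sub>R (\<Sum>i<n. hessian (fi i) x h))) (at x)"
      using F_der by (intro has_derivative_scaleR_right has_derivative_sum) auto
    moreover have "(\<lambda>h. (1 / real n) *\<^sub>R (\<Sum>i<n. hessian (fi i) x h))
        = blinfun_apply (avg n (\<lambda>i. hessian (fi i) x))"
      by (auto simp: avg_def blinfun.scaleR_left blinfun.sum_left)
    ultimately show "(grad f has_derivative blinfun_apply (avg n (\<lambda>i. hessian (fi i) x))) (at x)"
      unfolding grad_f[abs_def] by (simp add: avg_def)
  qed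
  have W: "W \<in> carrier_mat n n" using mixing unfolding mixing_matrix_def by auto
  have rows: "(\<Sum>j<n. W $$ (i, j)) = 1" if "i < n" for i
  proof -
    have "vec_index (W *\<^sub>v ones_vec n) i = (\<Sum>j<n. W $$ (i, j))"
      using W that by (auto simp: ones_vec_def scalar_prod_def lessThan_atLeast0)
    then show ?thesis using that unfolding A1_stochastic by (simp add: ones_vec_def)
  qed
  have cols: "(\<Sum>i<n. W $$ (i, j)) = 1" if "j < n" for j
  proof -
    have "vec_index (transpose_mat W *\<^sub>v ones_vec n) j = (\<Sum>i<n. W $$ (i, j))"
      using W that by (auto simp: ones_vec_def scalar_prod_def lessThan_atLeast0)
    then show ?thesis using that unfolding A1_stochastic by (simp add: ones_vec_def)
  qed
  have l_meas: "l x \<in> borel_measurable Z" for x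
    using borel_measurable_integrable[OF l_integrable[of 0 x]] B_sets[of 0] n
    by (simp cong: measurable_cong_sets)
  \<comment> \<open>The fourth-root bound on the step sizes makes \<open>1 + b * \<gamma>^4\<close> at most \<open>(1 - \<rho>/4) / (1 - \<rho>/2)\<close>.\<close>
  have step_ratio: "\<gamma> t ^ 4 * (1 - \<rho> / 2) \<le> (1 - \<rho> / 4) * \<gamma> (Suc t) ^ 4" if t: "t \<ge> 1" for t
  proof -
    let ?c = "(\<rho> / (4 * b)) / (1 - \<rho> / 2)" and ?s = "\<gamma> (Suc t)"
    have pos: "1 - \<rho> / 2 > 0" using A1_rho by auto
    have s: "?s > 0" by (rule \<gamma>_pos) simp
    have c: "?c \<ge> 0" using A1_rho b pos by simp
    have "?s \<le> root 4 ?c" using \<gamma>_bound(2)[of "Suc t"] by simp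
    then have "?s ^ 4 \<le> root 4 ?c ^ 4" using s by (intro power_mono) auto
    also have "\<dots> = ?c" using c by (intro real_root_pow_pos2) auto
    finally have "b * ?s ^ 4 \<le> b * ?c" using b by (intro mult_left_mono) auto
    also have "b * ?c = (\<rho> / 4) / (1 - \<rho> / 2)" using b by simp
    finally have "1 + b * ?s ^ 4 \<le> 1 + (\<rho> / 4) / (1 - \<rho> / 2)" by simp
    also have "\<dots> = (1 - \<rho> / 4) / (1 - \<rho> / 2)"
      using pos by (simp add: field_simps)
    finally have "\<gamma> t ^ 4 / ?s ^ 4 \<le> (1 - \<rho> / 4) / (1 - \<rho> / 2)"
      using \<gamma>_ratio[OF t] by simp
    then show ?thesis using s pos by (simp add: divide_le_eq le_divide_eq mult_ac)
  qed
  have step_L: "\<gamma> t * L \<le> \<rho> / 9" if t: "t \<ge> 1" for t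
  proof (cases "L > 0")
    case True
    then show ?thesis using \<gamma>_bound(1)[OF t] by (simp add: field_simps)
  next
    case False
    then show ?thesis using A2(1) A1_rho by simp
  qed
  have contraction: "stack_norm n (\<lambda>i. \<Sum>j<n. W $$ (i, j) *\<^sub>R x j) \<le> (1 - \<rho>) * stack_norm n x"
    if "(\<Sum>i<n. x i) = 0" for x :: "nat \<Rightarrow> real ^ 'd"
  proof (rule power2_le_imp_le)
    show "(stack_norm n (\<lambda>i. \<Sum>j<n. W $$ (i, j) *\<^sub>R x j))\<^sup>2 \<le> ((1 - \<rho>) * stack_norm n x)\<^sup>2"
      unfolding power_mult_distrib stack_norm_power2
      by (rule mixing_contracts[OF W cols A1_U A1_gap that])
  qed (use A1_rho in \<open>simp add: stack_norm_nonneg\<close>)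
  have init': "\<theta>0 i = avg n \<theta>0" if "i < n" for i
  proof -
    have "avg n \<theta>0 = avg n (\<lambda>_. \<theta>0 i)"
      unfolding avg_def using init[OF _ that] by simp
    then show ?thesis using avg_const[OF n, of "\<theta>0 i"] by simp
  qed
  interpret prob_space M by (rule M_prob)
  interpret dsgd_consensus M n Z B l F W \<zeta> \<gamma> \<theta>0 L \<sigma> \<rho> \<tau>
  proof unfold_locales
    show "(\<lambda>p. grad_loss l (fst p) (snd p)) \<in> borel_measurable (borel \<Otimes>\<^sub>M Z)"
      by (rule grad_loss_measurable[OF l_meas l_diff])
    show "norm (avg n (\<lambda>j. F j x) - F i x) \<le> \<tau>" if "i < n" for i x
      using A4(2)[OF that, of x] unfolding grad_f by (simp add: F_def)
  qed (use n \<zeta>_indep \<zeta>_distr A1_rho A2 A3 A4 A7 rows cols contraction \<gamma>_pos step_L step_ratio init'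
      in \<open>simp_all add: F_def\<close>)
  have mean: "\<theta>_bar t \<omega> = mean_iterate t \<omega>" for t \<omega>
    by (simp add: \<theta>_bar_def \<theta>_def mean_iterate_def iterate_def)
  have lower: "f x \<ge> f_star" for x
    unfolding f_star_def by (rule cINF_lower[OF f_bdd]) simp
  have hess_het: "norm (avg n (\<lambda>j. hessian (fi j) x) - hessian (fi i) x) \<le> \<tau>\<^sub>H" if "i < n" for i x
    using A6(2)[OF that, of x] unfolding hessian_f .
  note bound = sum_gradient_bound[OF f_grad F_der A5(1) A5(3) A6(1) hess_het lower, of T]
  let ?s = "\<lambda>k. \<Sum>t<T. \<gamma> (t + 1) ^ k"
  have s_nonneg: "?s k \<ge> 0" for k
    using \<gamma>_pos by (intro sum_nonneg zero_le_power) (simp add: less_imp_le)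
  show ?thesis
    unfolding mean grad_f
  proof
    show "integrable M (\<lambda>\<omega>. \<Sum>t<T. \<gamma> (t + 1) * norm (avg n (\<lambda>i. F i (mean_iterate t \<omega>))) ^ 2)"
      by (rule bound(1))
    show "(\<integral>\<omega>. (\<Sum>t<T. \<gamma> (t + 1) * norm (avg n (\<lambda>i. F i (mean_iterate t \<omega>))) ^ 2) \<partial>M)
      \<le> 4 * D + 2 * L * \<sigma> ^ 2 / real n * ?s 2
        + 432 * real n * L\<^sub>H ^ 2 / \<rho> ^ 4 * (\<sigma> ^ 4 + 4 * \<tau> ^ 4) * ?s 5
        + 32 * \<tau>\<^sub>H ^ 2 * (\<sigma> ^ 2 + \<tau> ^ 2) / \<rho> ^ 2 * ?s 3"
    proof (rule order_trans)
      show "(\<integral>\<omega>. (\<Sum>t<T. \<gamma> (t + 1) * norm (avg n (\<lambda>i. F i (mean_iterate t \<omega>))) ^ 2) \<partial>M)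
        \<le> 2 * (f (avg n \<theta>0) - f_star) + 2 * L * \<sigma>\<^sup>2 / real n * ?s 2
          + 432 * L\<^sub>H\<^sup>2 / \<rho> ^ 4 * (\<sigma> ^ 4 + 4 * \<tau> ^ 4) * ?s 5
          + 30 * \<tau>\<^sub>H\<^sup>2 * (\<sigma>\<^sup>2 + \<tau>\<^sup>2) / \<rho>\<^sup>2 * ?s 3"
        by (rule bound(2))
    next
      show "2 * (f (avg n \<theta>0) - f_star) + 2 * L * \<sigma>\<^sup>2 / real n * ?s 2
          + 432 * L\<^sub>H\<^sup>2 / \<rho> ^ 4 * (\<sigma> ^ 4 + 4 * \<tau> ^ 4) * ?s 5
          + 30 * \<tau>\<^sub>H\<^sup>2 * (\<sigma>\<^sup>2 + \<tau>\<^sup>2) / \<rho>\<^sup>2 * ?s 3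
        \<le> 4 * D + 2 * L * \<sigma> ^ 2 / real n * ?s 2
          + 432 * real n * L\<^sub>H ^ 2 / \<rho> ^ 4 * (\<sigma> ^ 4 + 4 * \<tau> ^ 4) * ?s 5
          + 32 * \<tau>\<^sub>H ^ 2 * (\<sigma> ^ 2 + \<tau> ^ 2) / \<rho> ^ 2 * ?s 3"
      proof (intro add_mono order_refl)
        show "2 * (f (avg n \<theta>0) - f_star) \<le> 4 * D"
          unfolding D_def using lower[of "avg n \<theta>0"] by simp
        show "432 * L\<^sub>H\<^sup>2 / \<rho> ^ 4 * (\<sigma> ^ 4 + 4 * \<tau> ^ 4) * ?s 5
          \<le> 432 * real n * L\<^sub>H ^ 2 / \<rho> ^ 4 * (\<sigma> ^ 4 + 4 * \<tau> ^ 4) * ?s 5"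
          using n s_nonneg[of 5] A1_rho by (intro mult_right_mono divide_right_mono) auto
        show "30 * \<tau>\<^sub>H\<^sup>2 * (\<sigma>\<^sup>2 + \<tau>\<^sup>2) / \<rho>\<^sup>2 * ?s 3
          \<le> 32 * \<tau>\<^sub>H ^ 2 * (\<sigma> ^ 2 + \<tau> ^ 2) / \<rho> ^ 2 * ?s 3"
          using s_nonneg[of 3] by (intro mult_right_mono divide_right_mono) auto
      qed
    qed
  qed
qed

end
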